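(* Let $f:\mathbb{R}^{n}\to\mathbb{R}_{\infty}$ be a proper lower semi-continuous function, quadratically minorised, and prox-regular at $\bar{x}$ for $0\in\partial f(\bar{x})$. Suppose in addition that $f$ admits a nontrivial subspace $\mathcal{U}^{2}:=\operatorname{dom} q\big(\underline{\partial}^{2}f(\bar{x},0)\big)(\cdot)$ and that $f$ has a tilt stable local minimum at $\bar{x}$. Then $\mathcal{U}^{2}\subseteq\mathcal{U}$, and for $g(w):=[\operatorname{co}h](w)$, $h(w):=f(\bar{x}+w)$ and $\{v(u)\}=\operatorname{argmin}_{v'\in\mathcal{V}^{2}\cap B_{\varepsilon}(0)}f(\bar{x}+u+v'):\mathcal{U}^{2}\to\mathcal{V}^{2}:=(\mathcal{U}^{2})^{\perp}$, there exists a $\delta>0$ such that for $u\in B_{\delta}^{\mathcal{U}^{2}}(0)$ we have $g(u+v(u))=f(\bar{x}+u+v(u))$, and $\nabla_{u}\,g(u+v(u))$ exists as a Lipschitz function of $u\in B_{\delta}^{\mathcal{U}^{2}}(0)$.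
   Context: Notation: $\mathbb{R}_{\infty}=\mathbb{R}\cup\{+\infty\}$; $\langle\cdot,\cdot\rangle$, $\|\cdot\|$ are Euclidean; balls are closed, and for a subspace $X$, $B_{\varepsilon}^{X}(0)=X\cap B_{\varepsilon}(0)$; $\operatorname{co}h$ is the function whose epigraph is the closed convex hull of $\operatorname{epi}h$. $x'\to_{f}x$ means $x'\to x$ and $f(x')\to f(x)$. $\mathcal{S}(n)$ is the set of symmetric $n\times n$ matrices. The number $\varepsilon>0$ in the definition of $v(\cdot)$ is a radius chosen consistently with tilt stability, i.e. small enough that $\bar x+B_{\varepsilon}^{\mathcal{U}^{2}}(0)\oplus B_{\varepsilon}^{\mathcal{V}^{2}}(0)$ lies in a ball about $\bar x$ on which tilt stability holds. Proximal subdifferential: $z\in\partial_{p}f(x)$ iff for some $r\ge 0$, $f(x')\ge f(x)+\langle z,x'-x\rangle-\frac r2\|x'-x\|^{2}$ for all $x'$ near $x$. Limiting subdifferential: $\partial f(x)=\{z\mid\exists x_{k}\to_{f}x,\ z_{k}\in\partial_{p}f(x_{k}),\ z_{k}\to z\}$. $f$ is quadratically minorised if there is a quadratic function $\alpha-\frac R2\|x-\bar x\|^{2}$ lying below $f$ globally. $f$ is prox-regular at $\bar x$ for $\bar z\in\partial f(\bar x)$ (with respect to some $\varepsilon>0$, $r\ge0$) if $f$ is finite at $\bar x$, locally lower semi-continuous at $\bar x$, and $f(x')\ge f(x)+\langle z,x'-x\rangle-\frac r2\|x'-x\|^{2}$ whenever $\|x'-\bar x\|\le\varepsilon$, $\|x-\bar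 x\|\le\varepsilon$, $|f(x)-f(\bar x)|\le\varepsilon$, $\|z-\bar z\|\le\varepsilon$, $z\in\partial f(x)$. $\bar x$ gives a tilt stable local minimum of $f$ if $f(\bar x)$ is finite and for some $\varepsilon>0$ the mapping $z\mapsto\operatorname{argmin}_{\|x-\bar x\|\le\varepsilon}\{f(x)-\langle x,z\rangle\}$ is single valued and Lipschitz on a neighbourhood of $0$ with value $\bar x$ at $z=0$. Subjet: $\partial^{2,-}f(x)=\{(\nabla\varphi(x),\nabla^{2}\varphi(x))\mid \varphi\in C^{2}(\mathbb{R}^{n}),\ f-\varphi\text{ has a local minimum at }x\}$. Limiting subjet: $\underline{\partial}^{2}f(x)$ is the set of limits of $(z_{k},Q_{k})\in\partial^{2,-}f(x_{k})$ with $x_{k}\to_{f}x$. Limiting subhessians: $\underline{\partial}^{2}f(x,z)=\{Q\in\mathcal{S}(n)\mid(z,Q)\in\underline{\partial}^{2}f(x)\}$. For $\mathcal{A}\subseteq\mathcal{S}(n)$, $q(\mathcal{A})(h)=\sup\{\langle Qh,h\rangle\mid Q\in\mathcal{A}\}$ and $\operatorname{dom}q(\mathcal{A})(\cdot)=\{h\mid q(\mathcal{A})(h)<\infty\}$. $\mathcal{VU}$-decomposition: when the relative interior of $\partial f(\bar x)$ is nonempty, take $\bar z\in\operatorname{rel-int}\partial f(\bar x)$ and put $\mathcal{V}:=\operatorname{span}\{\partial f(\bar x)-\bar z\}$, $\mathcal{U}:=\mathcal{V}^{\perp}$.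
   Formalization: h is f(x̄+·) on the box B_ε^{U²}(0)⊕B_ε^{V²}(0) and +∞ outside (with global h, co h can be −∞), and U²⊆U is claimed only when 0 lies in the closure of rel-int ∂f(x̄), which is automatic if ∂f(x̄) is convex; both literal claims are false in general. *)

theory Defs
  imports "HOL-Analysis.Analysis"
begin

section \<open>Extended-real-valued functions\<close>

definition proper_fun :: "('a \<Rightarrow> ereal) \<Rightarrow> bool" where
  "proper_fun f \<longleftrightarrow> (\<forall>x. f x \<noteq> -\<infinity>) \<and> (\<exists>x. f x \<noteq> \<infinity>)"

definition lsc_fun :: "('a::topological_space \<Rightarrow> ereal) \<Rightarrow> bool" where
  "lsc_fun f \<longleftrightarrow> (\<forall>x. f x \<le> Liminf (at x) f)"

text \<open>Local lower semicontinuity at a point where \<open>f\<close> is finite, in the sense of Rockafellar and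
  Wets: the epigraph is locally closed at \<open>(x, f x)\<close>.\<close>

definition locally_lsc_at :: "('a::metric_space \<Rightarrow> ereal) \<Rightarrow> 'a \<Rightarrow> bool" where
  "locally_lsc_at f x \<longleftrightarrow>
     (\<exists>e>0. \<forall>a::real. ereal a \<le> f x + ereal e \<longrightarrow> closed {y \<in> cball x e. f y \<le> ereal a})"

definition quadratically_minorised :: "('a::real_normed_vector \<Rightarrow> ereal) \<Rightarrow> 'a \<Rightarrow> bool" where
  "quadratically_minorised f xbar \<longleftrightarrow>
     (\<exists>\<alpha> R. \<forall>x. ereal (\<alpha> - R / 2 * (norm (x - xbar))\<^sup>2) \<le> f x)"

definition argmin_set :: "('a \<Rightarrow> ereal) \<Rightarrow> 'a set \<Rightarrow> 'a set" where
  "argmin_set f S = {x. is_arg_min f (\<lambda>y. y \<in> S) x}"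

definition epi :: "('a \<Rightarrow> ereal) \<Rightarrow> ('a \<times> real) set" where
  "epi h = {(x, t). h x \<le> ereal t}"

definition closed_convex_hull_fun :: "('a::real_normed_vector \<Rightarrow> ereal) \<Rightarrow> 'a \<Rightarrow> ereal" where
  "closed_convex_hull_fun h x = Inf {ereal t | t. (x, t) \<in> closure (convex hull (epi h))}"

text \<open>The value of \<open>closed_convex_hull_fun h\<close> is the lower boundary of the closed convex hull of the
  epigraph, so that its own epigraph is that hull.\<close>

lemma epi_closed_convex_hull_fun:
  fixes h :: "'a::real_normed_vector \<Rightarrow> ereal"
  shows "epi (closed_convex_hull_fun h) = closure (convex hull (epi h))" (is "_ = ?C")
proof -
  have up1: "(x, t + s) \<in> convex hull (epi h)" if "(x, t) \<in> convex hull (epi h)" "0 \<le> s" for x t s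
  proof -
    have "(\<lambda>p. (0, s) + p) ` (convex hull (epi h)) = convex hull ((\<lambda>p. (0, s) + p) ` epi h)"
      by (simp add: convex_hull_translation)
    also have "\<dots> \<subseteq> convex hull (epi h)"
    proof (rule hull_mono, clarsimp simp: epi_def)
      fix a b assume "h a \<le> ereal b"
      with that(2) show "h a \<le> ereal (s + b)"
        by (meson ereal_less_eq(3) le_add_same_cancel2 order_trans)
    qed
    finally show ?thesis using that(1) by (force simp: add.commute)
  qed
  have up: "(x, t + s) \<in> ?C" if xt: "(x, t) \<in> ?C" and s: "0 \<le> s" for x t s
  proof -
    have "(\<lambda>p. (0, s) + p) ` ?C = closure ((\<lambda>p. (0, s) + p) ` (convex hull (epi h)))"
      by (simp add: closure_translation)
    also have "\<dots> \<subseteq> ?C"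
      by (rule closure_mono) (use up1[OF _ s] in \<open>auto simp: add.commute\<close>)
    finally show ?thesis using xt by (force simp: add.commute)
  qed
  have "(x, t) \<in> ?C" if "closed_convex_hull_fun h x \<le> ereal t" for x t
  proof -
    have "(x, t + 1 / real (Suc n)) \<in> ?C" for n
    proof -
      have "closed_convex_hull_fun h x < ereal (t + 1 / real (Suc n))"
        by (rule le_less_trans[OF that]) simp
      then obtain b where "(x, b) \<in> ?C" "b < t + 1 / real (Suc n)"
        unfolding closed_convex_hull_fun_def Inf_less_iff by auto
      then show ?thesis using up[of x b "t + 1 / real (Suc n) - b"] by simp
    qed
    moreover have "(\<lambda>n. (x, t + 1 / real (Suc n))) \<longlonglongrightarrow> (x, t + 0)"
      by (intro tendsto_intros LIMSEQ_Suc[OF lim_1_over_n])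
    ultimately show ?thesis
      using closed_sequentially[OF closed_closure] by fastforce
  qed
  moreover have "closed_convex_hull_fun h x \<le> ereal t" if "(x, t) \<in> ?C" for x t
    unfolding closed_convex_hull_fun_def using that by (auto intro: Inf_lower)
  ultimately show ?thesis by (auto simp: epi_def)
qed

section \<open>Subdifferentials, prox-regularity, tilt stability\<close>

text \<open>Proximal subgradients and subjets are only considered at points where the function is finite.\<close>

definition proximal_subdiff :: "('a::real_inner \<Rightarrow> ereal) \<Rightarrow> 'a \<Rightarrow> 'a set" where
  "proximal_subdiff f x = {z. \<bar>f x\<bar> \<noteq> \<infinity> \<and>
     (\<exists>r\<ge>0. \<forall>\<^sub>F x' in nhds x.
        f x' \<ge> f x + ereal (z \<bullet> (x' - x) - r / 2 * (norm (x' - x))\<^sup>2))}"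

definition limiting_subdiff :: "('a::real_inner \<Rightarrow> ereal) \<Rightarrow> 'a \<Rightarrow> 'a set" where
  "limiting_subdiff f x = {z. \<exists>X Z. X \<longlonglongrightarrow> x \<and> (\<lambda>k. f (X k)) \<longlonglongrightarrow> f x \<and>
     (\<forall>k. Z k \<in> proximal_subdiff f (X k)) \<and> Z \<longlonglongrightarrow> z}"

definition prox_regular :: "('a::real_inner \<Rightarrow> ereal) \<Rightarrow> 'a \<Rightarrow> 'a \<Rightarrow> bool" where
  "prox_regular f xbar zbar \<longleftrightarrow>
     zbar \<in> limiting_subdiff f xbar \<and> \<bar>f xbar\<bar> \<noteq> \<infinity> \<and> locally_lsc_at f xbar \<and>
     (\<exists>\<epsilon>>0. \<exists>r\<ge>0. \<forall>x x' z.
        norm (x' - xbar) \<le> \<epsilon> \<and> norm (x - xbar) \<le> \<epsilon> \<and> \<bar>f x - f xbar\<bar> \<le> ereal \<epsilon> \<and>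
        norm (z - zbar) \<le> \<epsilon> \<and> z \<in> limiting_subdiff f x \<longrightarrow>
        f x' \<ge> f x + ereal (z \<bullet> (x' - x) - r / 2 * (norm (x' - x))\<^sup>2))"

text \<open>Tilt stability at \<open>xbar\<close>, witnessed on the closed ball of radius \<open>\<rho>\<close>.\<close>

definition tilt_stable_on_radius :: "('a::real_inner \<Rightarrow> ereal) \<Rightarrow> 'a \<Rightarrow> real \<Rightarrow> bool" where
  "tilt_stable_on_radius f xbar \<rho> \<longleftrightarrow> \<rho> > 0 \<and> \<bar>f xbar\<bar> \<noteq> \<infinity> \<and>
     (\<exists>m \<eta> L. \<eta> > 0 \<and>
        (\<forall>z \<in> ball 0 \<eta>. argmin_set (\<lambda>x. f x - ereal (x \<bullet> z)) (cball xbar \<rho>) = {m z}) \<and>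
        L-lipschitz_on (ball 0 \<eta>) m \<and> m 0 = xbar)"

definition tilt_stable_local_min :: "('a::real_inner \<Rightarrow> ereal) \<Rightarrow> 'a \<Rightarrow> bool" where
  "tilt_stable_local_min f xbar \<longleftrightarrow> (\<exists>\<rho>. tilt_stable_on_radius f xbar \<rho>)"

section \<open>Subjets and limiting subhessians\<close>

definition C2_with :: "(real^'n \<Rightarrow> real) \<Rightarrow> (real^'n \<Rightarrow> real^'n) \<Rightarrow> (real^'n \<Rightarrow> real^'n^'n) \<Rightarrow> bool" where
  "C2_with \<phi> G H \<longleftrightarrow>
     (\<forall>x. (\<phi> has_derivative (\<lambda>d. G x \<bullet> d)) (at x)) \<and>
     (\<forall>x. (G has_derivative (\<lambda>d. H x *v d)) (at x)) \<and>
     continuous_on UNIV H"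

definition subjet :: "(real^'n \<Rightarrow> ereal) \<Rightarrow> real^'n \<Rightarrow> ((real^'n) \<times> (real^'n^'n)) set" where
  "subjet f x = {(G x, H x) | \<phi> G H. C2_with \<phi> G H \<and> \<bar>f x\<bar> \<noteq> \<infinity> \<and>
     (\<forall>\<^sub>F y in nhds x. f x - ereal (\<phi> x) \<le> f y - ereal (\<phi> y))}"

definition limiting_subjet :: "(real^'n \<Rightarrow> ereal) \<Rightarrow> real^'n \<Rightarrow> ((real^'n) \<times> (real^'n^'n)) set" where
  "limiting_subjet f x = {(z, Q). \<exists>X P. X \<longlonglongrightarrow> x \<and> (\<lambda>k. f (X k)) \<longlonglongrightarrow> f x \<and>
     (\<forall>k. P k \<in> subjet f (X k)) \<and> P \<longlonglongrightarrow> (z, Q)}"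

definition limiting_subhessians :: "(real^'n \<Rightarrow> ereal) \<Rightarrow> real^'n \<Rightarrow> real^'n \<Rightarrow> (real^'n^'n) set" where
  "limiting_subhessians f x z = {Q. transpose Q = Q \<and> (z, Q) \<in> limiting_subjet f x}"

definition q_support :: "(real^'n^'n) set \<Rightarrow> real^'n \<Rightarrow> ereal" where
  "q_support A h = (SUP Q\<in>A. ereal ((Q *v h) \<bullet> h))"

definition dom_q :: "(real^'n^'n) set \<Rightarrow> (real^'n) set" where
  "dom_q A = {h. q_support A h < \<infinity>}"

section \<open>The two subspaces\<close>

definition U2 :: "(real^'n \<Rightarrow> ereal) \<Rightarrow> real^'n \<Rightarrow> (real^'n) set" where
  "U2 f xbar = dom_q (limiting_subhessians f xbar 0)"

definition VU_V :: "('a::real_inner \<Rightarrow> ereal) \<Rightarrow> 'a \<Rightarrow> 'a \<Rightarrow> 'a set" where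
  "VU_V f xbar zbar = span ((\<lambda>z. z - zbar) ` limiting_subdiff f xbar)"

definition VU_U :: "('a::real_inner \<Rightarrow> ereal) \<Rightarrow> 'a \<Rightarrow> 'a \<Rightarrow> 'a set" where
  "VU_U f xbar zbar = orthogonal_comp (VU_V f xbar zbar)"

section \<open>The localised function and the selection \<open>v\<close>\<close>

definition box_sum :: "'a::real_inner set \<Rightarrow> real \<Rightarrow> 'a set" where
  "box_sum U \<epsilon> = {u + v | u v. u \<in> U \<inter> cball 0 \<epsilon> \<and> v \<in> orthogonal_comp U \<inter> cball 0 \<epsilon>}"

text \<open>The function \<open>w \<mapsto> f (xbar + w)\<close> is restricted to the region on which tilt stability is
  available. Without a restriction its closed convex hull need not agree with \<open>f\<close> anywhere near
  \<open>xbar\<close>: it is identically \<open>-\<infinity>\<close> for \<open>f x = min (x\<^sup>2) (2 - x\<^sup>2)\<close>, although \<open>0\<close> is a tilt stable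
  local minimum and \<open>f\<close> is quadratically minorised.\<close>

definition local_fun :: "('a::real_inner \<Rightarrow> ereal) \<Rightarrow> 'a \<Rightarrow> 'a set \<Rightarrow> real \<Rightarrow> 'a \<Rightarrow> ereal" where
  "local_fun f xbar U \<epsilon> w = (if w \<in> box_sum U \<epsilon> then f (xbar + w) else \<infinity>)"

definition v_argmin :: "('a::real_inner \<Rightarrow> ereal) \<Rightarrow> 'a \<Rightarrow> 'a set \<Rightarrow> real \<Rightarrow> 'a \<Rightarrow> 'a set" where
  "v_argmin f xbar U \<epsilon> u =
     argmin_set (\<lambda>v'. f (xbar + u + v')) (orthogonal_comp U \<inter> cball 0 \<epsilon>)"

text \<open>Only meaningful where the argmin set is a singleton.\<close>

definition v_sel :: "('a::real_inner \<Rightarrow> ereal) \<Rightarrow> 'a \<Rightarrow> 'a set \<Rightarrow> real \<Rightarrow> 'a \<Rightarrow> 'a" where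
  "v_sel f xbar U \<epsilon> u = (THE v. v_argmin f xbar U \<epsilon> u = {v})"

text \<open>\<open>z\<close> is the gradient at \<open>u\<close> of \<open>F\<close> regarded as a function on the subspace \<open>U\<close>; in particular
  \<open>F\<close> is finite on a neighbourhood of \<open>u\<close> in \<open>U\<close>.\<close>

definition has_gradient_in :: "'a::real_inner set \<Rightarrow> ('a \<Rightarrow> ereal) \<Rightarrow> 'a \<Rightarrow> 'a \<Rightarrow> bool" where
  "has_gradient_in U F z u \<longleftrightarrow> u \<in> U \<and> z \<in> U \<and> \<bar>F u\<bar> \<noteq> \<infinity> \<and>
     (\<forall>\<^sub>F u' in at u within U. \<bar>F u'\<bar> \<noteq> \<infinity>) \<and>
     ((\<lambda>u'. real_of_ereal (F u')) has_derivative (\<lambda>d. z \<bullet> d)) (at u within U)"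

end

theory Submission
  imports Defs
begin

text \<open>Let \<open>m z\<close> be the tilted minimiser. The conjugate of \<open>f\<close> restricted to the ball is convex near
  \<open>0\<close> with Lipschitz gradient \<open>m\<close>. If \<open>m\<close> were not strongly monotone on \<open>U2\<close> near \<open>0\<close>, quadratics
  with arbitrarily small curvature along some unit vector of \<open>U2\<close> would touch the conjugate from
  above at points close to \<open>0\<close>; inverting them gives subjets of \<open>f\<close>, hence limiting subhessians
  with arbitrarily large curvature along \<open>U2\<close>, although their support function is finite on an
  orthonormal basis of \<open>U2\<close>. Strong monotonicity lets one solve
  \<open>u = P (m z - xbar)\<close>, with \<open>P\<close> the projection onto \<open>U2\<close>, for \<open>z\<close> in \<open>U2\<close> as a Lipschitz
  function of \<open>u\<close>. Then \<open>v u = m z - xbar - u\<close>, the tilt \<open>z\<close> supports \<open>f\<close> at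
  \<open>xbar + u + v u\<close>, so the convex hull agrees with \<open>f\<close> there, and \<open>z\<close> is the gradient at \<open>u\<close>.

  For the first claim, prox-regularity along the relatively open set of subgradients near \<open>0\<close>
  yields a minorant with a term \<open>t * \<bar>d \<bullet> w\<bar>\<close>, which beats \<open>k / 2 * (d \<bullet> w)\<^sup>2\<close> for every \<open>k\<close>.\<close>

section \<open>Quadratic minorants and subjets\<close>

text \<open>The matrix \<alpha> h h^T + \<beta> I. For a unit vector \<open>h\<close> its quadratic
  form has curvature \<alpha> + \<beta> along \<open>h\<close> and \<beta> across.\<close>

definition rank1_matrix :: "real \<Rightarrow> real^'n \<Rightarrow> real \<Rightarrow> real^'n^'n" where
  "rank1_matrix \<alpha> h \<beta> = (\<chi> i j. \<alpha> * (h $ i * h $ j) + (if i = j then \<beta> else 0))"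

lemma rank1_matrix_mult: "rank1_matrix \<alpha> h \<beta> *v w = (\<alpha> * (h \<bullet> w)) *\<^sub>R h + \<beta> *\<^sub>R w"
proof -
  have "(\<Sum>j\<in>UNIV. (\<alpha> * (h $ i * h $ j) + (if i = j then \<beta> else 0)) * w $ j)
      = \<alpha> * (\<Sum>j\<in>UNIV. h $ j * w $ j) * h $ i + \<beta> * w $ i" for i
  proof -
    have "(\<Sum>j\<in>UNIV. (\<alpha> * (h $ i * h $ j) + (if i = j then \<beta> else 0)) * w $ j)
        = (\<Sum>j\<in>UNIV. \<alpha> * (h $ j * w $ j) * h $ i + (if i = j then \<beta> * w $ j else 0))"
      by (intro sum.cong) (auto simp: algebra_simps)
    then show ?thesis
      by (simp add: sum.distrib sum_distrib_left sum_distrib_right)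
  qed
  then show ?thesis
    by (simp add: vec_eq_iff rank1_matrix_def matrix_vector_mult_def inner_vec_def)
qed

lemma transpose_rank1_matrix: "transpose (rank1_matrix \<alpha> h \<beta>) = rank1_matrix \<alpha> h \<beta>"
  by (auto simp: rank1_matrix_def transpose_def vec_eq_iff)

lemma tendsto_rank1_matrix:
  assumes "(h \<longlongrightarrow> h0) F"
  shows "((\<lambda>k. rank1_matrix \<alpha> (h k) \<beta>) \<longlongrightarrow> rank1_matrix \<alpha> h0 \<beta>) F"
  unfolding rank1_matrix_def
  by (intro tendsto_vec_lambda tendsto_intros tendsto_vec_nth assms)

text \<open>The quadratic minorant itself is the test function; symmetry of \<open>Q\<close> makes
  \<open>z + Q *v (y - x)\<close> its gradient, which is \<open>z\<close> at
  \<open>x\<close>.\<close>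

lemma subjet_quadraticI:
  fixes f :: "real^'n \<Rightarrow> ereal"
  assumes fin: "\<bar>f x\<bar> \<noteq> \<infinity>" and sym: "transpose Q = Q"
    and minor: "\<forall>\<^sub>F y in nhds x. f x + ereal (z \<bullet> (y - x) + (Q *v (y - x)) \<bullet> (y - x) / 2) \<le> f y"
  shows "(z, Q) \<in> subjet f x"
proof -
  define \<phi> where "\<phi> y = z \<bullet> (y - x) + (Q *v (y - x)) \<bullet> (y - x) / 2" for y
  have lin: "((\<lambda>y. Q *v (y - x)) has_derivative (\<lambda>d. Q *v d)) (at y)" for y
    by (rule bounded_linear.has_derivative[OF matrix_vector_mul_bounded_linear])
      (auto intro!: derivative_eq_intros)
  have symm: "(Q *v a) \<bullet> b = a \<bullet> (Q *v b)" for a b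
    using sym by (metis dot_lmul_matrix transpose_matrix_vector)
  have "C2_with \<phi> (\<lambda>y. z + Q *v (y - x)) (\<lambda>_. Q)"
    unfolding C2_with_def
  proof (intro conjI allI)
    fix y
    have "(\<phi> has_derivative
        (\<lambda>d. z \<bullet> d + ((Q *v (y - x)) \<bullet> d + (Q *v d) \<bullet> (y - x)) / 2)) (at y)"
      unfolding \<phi>_def by (auto intro!: derivative_eq_intros lin)
    then show "(\<phi> has_derivative (\<lambda>d. (z + Q *v (y - x)) \<bullet> d)) (at y)"
      by (rule has_derivative_eq_rhs) (simp add: symm[of _ "y - x"] inner_commute[of _ "Q *v (y - x)"] inner_add_left)
    show "((\<lambda>y. z + Q *v (y - x)) has_derivative (\<lambda>d. Q *v d)) (at y)"
      by (auto intro!: derivative_eq_intros lin)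
  qed auto
  moreover have "\<forall>\<^sub>F y in nhds x. f x - ereal (\<phi> x) \<le> f y - ereal (\<phi> y)"
    using minor
  proof eventually_elim
    case (elim y)
    then show ?case
      using fin unfolding \<phi>_def by (cases "f x"; cases "f y") auto
  qed
  ultimately have "(z + Q *v (x - x), Q) \<in> subjet f x"
    using fin unfolding subjet_def mem_Collect_eq
    by (intro exI[of _ \<phi>] exI[of _ "\<lambda>y. z + Q *v (y - x)"] exI[of _ "\<lambda>_. Q"]) auto
  then show ?thesis by simp
qed

lemma q_support_ge:
  assumes "Q \<in> A" shows "ereal ((Q *v h) \<bullet> h) \<le> q_support A h"
  unfolding q_support_def using assms by (rule SUP_upper)

section \<open>Inclusion of \<open>U2\<close> in the U-space\<close>

text \<open>If \<open>h\<close> in \<open>U2\<close> were not orthogonal to some \<open>d\<close> in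
  the V-space, subhessians k d d^T - r I for every \<open>k > 0\<close> would make the support
  function infinite at \<open>h\<close>. They arise at \<open>xbar\<close> itself, from relatively
  interior subgradients tending to \<open>0\<close>. The hypothesis \<open>closure\<close> supplies
  these, as \<open>0\<close> need not be relatively interior.\<close>

lemma U2_subset_VU_U:
  fixes f :: "real^'n \<Rightarrow> ereal"
  assumes prox: "prox_regular f xbar 0"
    and zbar: "zbar \<in> rel_interior (limiting_subdiff f xbar)"
    and closure: "0 \<in> closure (rel_interior (limiting_subdiff f xbar))"
  shows "U2 f xbar \<subseteq> VU_U f xbar zbar"
proof -
  define S where "S = limiting_subdiff f xbar"
  from prox obtain \<epsilon> r where e: "\<epsilon> > 0" and fin: "\<bar>f xbar\<bar> \<noteq> \<infinity>" and zero: "0 \<in> S"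
    and reg: "\<And>x x' z. \<lbrakk>norm (x' - xbar) \<le> \<epsilon>; norm (x - xbar) \<le> \<epsilon>; \<bar>f x - f xbar\<bar> \<le> ereal \<epsilon>;
        norm z \<le> \<epsilon>; z \<in> limiting_subdiff f x\<rbrakk>
        \<Longrightarrow> f x' \<ge> f x + ereal (z \<bullet> (x' - x) - r / 2 * (norm (x' - x))\<^sup>2)"
    unfolding prox_regular_def S_def diff_zero by metis
  have reg': "f xbar + ereal (z \<bullet> (y - xbar) - r / 2 * (norm (y - xbar))\<^sup>2) \<le> f y"
    if "norm (y - xbar) \<le> \<epsilon>" "norm z \<le> \<epsilon>" "z \<in> S" for y z
    using reg[of y xbar z] that e fin unfolding S_def by (cases "f xbar") auto
  have sub: "(z, rank1_matrix k d (-r)) \<in> subjet f xbar"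
    if z: "z \<in> rel_interior S" "norm z < \<epsilon>" and d: "d \<in> VU_V f xbar zbar" and k: "k > 0" for z d k
  proof -
    obtain s where s: "s > 0" "ball z s \<inter> affine hull S \<subseteq> S" and zS: "z \<in> S"
      using z(1) unfolding mem_rel_interior_ball by auto
    \<comment> \<open>Since \<open>0\<close> lies in \<open>S\<close>, the affine hull is a linear
      subspace; it contains \<open>d\<close>, so small moves of \<open>z\<close> along
      \<open>d\<close> stay in \<open>S\<close>.\<close>
    have aff: "affine hull S = span S"
      using zero by (simp add: affine_hull_span_0 hull_inc)
    have "zbar \<in> S"
      using zbar rel_interior_subset unfolding S_def by blast
    have "d \<in> span S"
    proof -
      have "span ((\<lambda>w. w - zbar) ` S) \<subseteq> span S"
        using \<open>zbar \<in> S\<close> by (intro span_minimal) (auto intro: span_diff span_base)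
      then show ?thesis using d unfolding VU_V_def S_def by auto
    qed
    define M where "M = min s (\<epsilon> - norm z)"
    have M: "M > 0" "M \<le> s" "M \<le> \<epsilon> - norm z"
      using s(1) z(2) unfolding M_def by auto
    \<comment> \<open>Then \<open>t * norm d < M\<close>, which keeps both z + t d and z - t d in
      \<open>S\<close> and within the prox-regularity radius; the summand 1 covers
      \<open>d = 0\<close>.\<close>
    define t where "t = M / (2 * (norm d + 1))"
    have t: "t > 0"
      using M unfolding t_def by (auto intro!: divide_pos_pos add_nonneg_pos)
    have "2 * (norm d + 1) > 0" by (auto intro!: add_nonneg_pos)
    then have "t * (2 * (norm d + 1)) = M" unfolding t_def by simp
    then have "t * norm d < M" using t M by (simp add: algebra_simps)
    then have td: "t * norm d < s" "t * norm d < \<epsilon> - norm z" using M by auto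
    have mem: "z + a *\<^sub>R d \<in> S \<and> norm (z + a *\<^sub>R d) \<le> \<epsilon>" if "\<bar>a\<bar> = t" for a
    proof
      have "z + a *\<^sub>R d \<in> span S"
        using zS \<open>d \<in> span S\<close> by (intro span_add span_scale) (auto intro: span_base)
      moreover have "z + a *\<^sub>R d \<in> ball z s"
        using td that by (simp add: dist_norm)
      ultimately show "z + a *\<^sub>R d \<in> S" using s aff by auto
      show "norm (z + a *\<^sub>R d) \<le> \<epsilon>"
        using norm_triangle_ineq[of z "a *\<^sub>R d"] td that by simp
    qed
    \<comment> \<open>On this slab, with \<open>w = y - xbar\<close>, the term
      \<open>k / 2 * (d \<bullet> w)\<^sup>2\<close> is at most
      \<open>t * \<bar>d \<bullet> w\<bar>\<close>.\<close>
    have ev: "\<forall>\<^sub>F y in nhds xbar. \<bar>d \<bullet> (y - xbar)\<bar> < 2 * t / k"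
    proof (rule order_tendstoD)
      show "((\<lambda>y. \<bar>d \<bullet> (y - xbar)\<bar>) \<longlongrightarrow> \<bar>d \<bullet> (xbar - xbar)\<bar>) (nhds xbar)"
        by (intro tendsto_intros filterlim_ident)
    qed (use t k in simp)
    have ev2: "\<forall>\<^sub>F y in nhds xbar. norm (y - xbar) < \<epsilon>"
      using e by (auto simp: eventually_nhds_metric dist_norm)
    have "\<forall>\<^sub>F y in nhds xbar. f xbar + ereal (z \<bullet> (y - xbar) +
        (rank1_matrix k d (-r) *v (y - xbar)) \<bullet> (y - xbar) / 2) \<le> f y"
      using ev ev2
    proof eventually_elim
      case (elim y)
      define w where "w = y - xbar"
      \<comment> \<open>The sign is chosen so that
        \<open>a * (d \<bullet> w) = t * \<bar>d \<bullet> w\<bar>\<close>.\<close>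
      define a where "a = (if d \<bullet> w \<ge> 0 then t else - t)"
      have "k * \<bar>d \<bullet> w\<bar> * \<bar>d \<bullet> w\<bar> \<le> 2 * t * \<bar>d \<bullet> w\<bar>"
        using elim(1) k unfolding w_def by (intro mult_right_mono) (auto simp: field_simps)
      then have "k * (d \<bullet> w)\<^sup>2 / 2 \<le> a * (d \<bullet> w)"
        unfolding a_def by (auto simp: power2_eq_square abs_if split: if_splits)
      then have "z \<bullet> w + (rank1_matrix k d (-r) *v w) \<bullet> w / 2
          \<le> (z + a *\<^sub>R d) \<bullet> w - r / 2 * (norm w)\<^sup>2"
        unfolding power2_norm_eq_inner
        by (simp add: rank1_matrix_mult inner_simps field_simps power2_eq_square)
      then have "f xbar + ereal (z \<bullet> w + (rank1_matrix k d (-r) *v w) \<bullet> w / 2)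
          \<le> f xbar + ereal ((z + a *\<^sub>R d) \<bullet> w - r / 2 * (norm w)\<^sup>2)"
        by (intro add_left_mono) simp
      also have "\<dots> \<le> f y"
        using reg'[of y "z + a *\<^sub>R d"] mem[of a] elim(2) t unfolding w_def a_def by auto
      finally show ?case unfolding w_def .
    qed
    then show ?thesis
      by (intro subjet_quadraticI fin transpose_rank1_matrix)
  qed
  have "h \<bullet> d = 0" if h: "h \<in> U2 f xbar" and d: "d \<in> VU_V f xbar zbar" for h d
  proof (rule ccontr)
    assume hd: "h \<bullet> d \<noteq> 0"
    have "ereal (k * (h \<bullet> d)\<^sup>2 - r * (h \<bullet> h)) \<le> q_support (limiting_subhessians f xbar 0) h"
      if k: "k > 0" for k
    proof -
      have "0 \<in> closure (rel_interior S \<inter> ball 0 \<epsilon>)"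
        using open_Int_closure_subset[OF open_ball, of 0 \<epsilon> "rel_interior S"] closure e
        unfolding S_def by (auto simp: Int_commute)
      then obtain Z where Z: "\<And>n. Z n \<in> rel_interior S \<inter> ball 0 \<epsilon>" "Z \<longlonglongrightarrow> 0"
        unfolding closure_sequential by blast
      have "(0, rank1_matrix k d (-r)) \<in> limiting_subjet f xbar"
        unfolding limiting_subjet_def
        by (auto intro!: exI[of _ "\<lambda>_. xbar"] exI[of _ "\<lambda>n. (Z n, rank1_matrix k d (-r))"]
            tendsto_intros Z sub[OF _ _ d k] simp: Z[simplified])
      then have "rank1_matrix k d (-r) \<in> limiting_subhessians f xbar 0"
        unfolding limiting_subhessians_def by (simp add: transpose_rank1_matrix)
      from q_support_ge[OF this, of h] show ?thesis
        by (simp add: rank1_matrix_mult inner_simps power2_eq_square inner_commute mult.assoc)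
    qed
    note lower = this
    obtain B where B: "q_support (limiting_subhessians f xbar 0) h \<le> ereal B"
      using h unfolding U2_def dom_q_def
      by (cases "q_support (limiting_subhessians f xbar 0) h") auto
    \<comment> \<open>This \<open>k\<close> pushes the lower bound to at least
      \<open>B + 1\<close>.\<close>
    define k where "k = (\<bar>B + r * (h \<bullet> h)\<bar> + 1) / (h \<bullet> d)\<^sup>2"
    have "k > 0" unfolding k_def using hd by (auto intro!: divide_pos_pos)
    moreover have "k * (h \<bullet> d)\<^sup>2 = \<bar>B + r * (h \<bullet> h)\<bar> + 1" unfolding k_def using hd by simp
    ultimately show False
      using order_trans[OF lower B, of k] by simp
  qed
  then show ?thesis
    unfolding VU_U_def orthogonal_comp_def orthogonal_def by (auto simp: inner_commute)
qed

section \<open>Touching a smooth convex function from above\<close>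

text \<open>Divide by \<open>t\<close> and let it decrease to 0. This extracts first-order
  conditions from minimality along a ray.\<close>

lemma nonneg_of_quadratic_expansion:
  fixes a b :: real
  assumes "\<forall>\<^sub>F t in at_right 0. 0 \<le> t * a + t\<^sup>2 * b"
  shows "0 \<le> a"
proof (rule tendsto_le[of "at_right (0::real)"])
  show "((\<lambda>t. a + t * b) \<longlongrightarrow> a) (at_right 0)"
    by (auto intro!: tendsto_eq_intros)
  show "\<forall>\<^sub>F t in at_right 0. 0 \<le> a + t * b"
    using assms eventually_at_right_less[of 0]
  proof eventually_elim
    case (elim t)
    have "t * a + t\<^sup>2 * b = t * (a + t * b)" by (simp add: power2_eq_square algebra_simps)
    with elim show ?case by (simp add: zero_le_mult_iff)
  qed
qed (auto intro: tendsto_const)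

text \<open>The subgradient inequality at \<open>z'\<close> bounds the increase by
  \<open>p z' \<bullet> (z' - z)\<close>, and replacing \<open>p z'\<close> by \<open>p z\<close>
  costs the Lipschitz term. Compared with integrating \<open>p\<close> along the segment, only a
  factor 1/2 is lost.\<close>

lemma upper_estimate_of_subgradients:
  fixes \<psi> :: "'a::real_inner \<Rightarrow> real"
  assumes sub: "\<And>z z'. z \<in> S \<Longrightarrow> z' \<in> S \<Longrightarrow> \<psi> z + p z \<bullet> (z' - z) \<le> \<psi> z'"
    and lip: "L-lipschitz_on S p" and z: "z \<in> S" "z' \<in> S"
  shows "\<psi> z' \<le> \<psi> z + p z \<bullet> (z' - z) + L * (norm (z' - z))\<^sup>2"
proof -
  have "(p z' - p z) \<bullet> (z' - z) \<le> norm (p z' - p z) * norm (z' - z)"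
    by (rule norm_cauchy_schwarz)
  also have "\<dots> \<le> L * norm (z' - z) * norm (z' - z)"
    using lipschitz_onD[OF lip z(2,1)] by (intro mult_right_mono) (auto simp: dist_norm)
  finally show ?thesis
    using sub[OF z(2,1)] by (simp add: inner_simps power2_eq_square)
qed

lemma has_derivative_quadratic_error:
  fixes f :: "'a::real_normed_vector \<Rightarrow> 'b::real_normed_vector"
  assumes D: "bounded_linear D"
    and err: "\<forall>\<^sub>F y in at x within S. norm (f y - f x - D (y - x)) \<le> C * (norm (y - x))\<^sup>2"
  shows "(f has_derivative D) (at x within S)"
  unfolding has_derivative_iff_norm
proof (intro conjI D)
  have "((\<lambda>y. \<bar>C\<bar> * norm (y - x)) \<longlongrightarrow> \<bar>C\<bar> * norm (x - x)) (at x within S)"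
    by (intro tendsto_intros)
  then have lim: "((\<lambda>y. \<bar>C\<bar> * norm (y - x)) \<longlongrightarrow> 0) (at x within S)" by simp
  show "((\<lambda>y. norm (f y - f x - D (y - x)) / norm (y - x)) \<longlongrightarrow> 0) (at x within S)"
  proof (rule tendsto_sandwich[OF _ _ tendsto_const lim])
    show "\<forall>\<^sub>F y in at x within S. norm (f y - f x - D (y - x)) / norm (y - x) \<le> \<bar>C\<bar> * norm (y - x)"
      using err
    proof eventually_elim
      case (elim y)
      have "C * (norm (y - x))\<^sup>2 \<le> \<bar>C\<bar> * (norm (y - x))\<^sup>2" by (intro mult_right_mono) auto
      with elim have "norm (f y - f x - D (y - x)) \<le> \<bar>C\<bar> * (norm (y - x))\<^sup>2"
        by (rule order_trans)
      then show ?case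
        by (cases "y = x") (simp_all add: divide_le_eq power2_eq_square mult.assoc)
    qed
  qed auto
qed

text \<open>The linearisation error lies between 0, by the subgradient inequality, and a quadratic,
  by the upper estimate.\<close>

lemma has_derivative_of_subgradients:
  fixes \<psi> :: "'a::real_inner \<Rightarrow> real"
  assumes sub: "\<And>z z'. z \<in> S \<Longrightarrow> z' \<in> S \<Longrightarrow> \<psi> z + p z \<bullet> (z' - z) \<le> \<psi> z'"
    and lip: "L-lipschitz_on S p" and z: "z \<in> S"
  shows "(\<psi> has_derivative (\<lambda>d. p z \<bullet> d)) (at z within S)"
proof (rule has_derivative_quadratic_error)
  show "\<forall>\<^sub>F y in at z within S. norm (\<psi> y - \<psi> z - p z \<bullet> (y - z)) \<le> L * (norm (y - z))\<^sup>2"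
    unfolding eventually_at_filter
    using upper_estimate_of_subgradients[OF sub lip z] sub[OF z]
    by (intro always_eventually) (force simp: abs_le_iff)
qed (rule bounded_linear_inner_right)

text \<open>If the gradient grows slowly along a segment in direction \<open>h\<close>, then a quadratic with small
  curvature \<open>2 * c\<close> along \<open>h\<close> and large curvature \<open>2 * K\<close> across touches \<open>\<psi>\<close> from above
  near the segment: the linear part is chosen so that the difference has an interior
  minimum in a tube around the segment. This replaces almost everywhere second order
  differentiability.\<close>

lemma upper_quadratic_touching:
  fixes \<psi> :: "'a::euclidean_space \<Rightarrow> real"
  assumes sub: "\<And>z z'. z \<in> S \<Longrightarrow> z' \<in> S \<Longrightarrow> \<psi> z + p z \<bullet> (z' - z) \<le> \<psi> z'"
    and lip: "L-lipschitz_on S p" and L: "L > 0" and c: "c > 0"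
    and K: "K > 2 * L" "c * (K - L) > L\<^sup>2"
    and h: "norm h = 1" and l: "l > 0" and S: "cball a (2 * l) \<subseteq> S"
    and slow: "(p (a + (l / 2) *\<^sub>R h) - p (a - (l / 2) *\<^sub>R h)) \<bullet> h < c * l"
  obtains z0 where "z0 \<in> ball a (2 * l)"
    "\<forall>\<^sub>F s in nhds 0. \<psi> (z0 + s) \<le> \<psi> z0 + p z0 \<bullet> s + c * (h \<bullet> s)\<^sup>2 + K * ((norm s)\<^sup>2 - (h \<bullet> s)\<^sup>2)"
proof -
  have hh: "h \<bullet> h = 1" using h by (simp add: norm_eq_1)
  \<comment> \<open>The mean of the two end slopes along \<open>h\<close>. Below, \<beta> has slope
    \<open>m\<close> along \<open>h\<close> and agrees with \<open>p a\<close> across, and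
    \<open>D\<close> is the candidate quadratic minus \<psi>.\<close>
  define m where "m = (p (a + (l / 2) *\<^sub>R h) + p (a - (l / 2) *\<^sub>R h)) \<bullet> h / 2"
  define \<beta> where "\<beta> = p a + (m - p a \<bullet> h) *\<^sub>R h"
  define D where "D z = \<beta> \<bullet> z + c * (h \<bullet> (z - a))\<^sup>2 + K * ((norm (z - a))\<^sup>2 - (h \<bullet> (z - a))\<^sup>2) - \<psi> z" for z
  \<comment> \<open>Across the axis the linear part of \<open>D\<close> is exact at
    \<open>a\<close>; at distance \<open>\<bar>t\<bar>\<close> along the axis it is off by at most
    \<open>L * \<bar>t\<bar>\<close>, and curvature \<open>K\<close> beats the quadratic growth of
    \<psi>.\<close>
  have across: "D (a + t *\<^sub>R h + y) \<ge> D (a + t *\<^sub>R h) + (K - L) * (norm y)\<^sup>2 - L * \<bar>t\<bar> * norm y"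
    if t: "\<bar>t\<bar> \<le> l / 2" and y: "h \<bullet> y = 0" "norm y \<le> l" for t y
  proof -
    let ?z = "a + t *\<^sub>R h"
    have "norm (t *\<^sub>R h + y) \<le> 2 * l" "norm (t *\<^sub>R h) \<le> 2 * l"
      using t y(2) h l norm_triangle_ineq[of "t *\<^sub>R h" y] by auto
    then have z: "?z \<in> S" "?z + y \<in> S" "a \<in> S"
      using l by (auto intro!: subsetD[OF S] simp: dist_norm norm_minus_commute add.assoc
          simp flip: norm_minus_cancel[of "t *\<^sub>R h + y"])
    have "(p ?z - p a) \<bullet> y \<le> norm (p ?z - p a) * norm y" by (rule norm_cauchy_schwarz)
    also have "\<dots> \<le> (L * \<bar>t\<bar>) * norm y"
      using lipschitz_onD[OF lip z(1,3)] h by (intro mult_right_mono) (auto simp: dist_norm)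
    finally have 1: "p ?z \<bullet> y \<le> p a \<bullet> y + L * \<bar>t\<bar> * norm y" by (simp add: inner_simps)
    have 2: "\<psi> (?z + y) \<le> \<psi> ?z + p ?z \<bullet> y + L * (norm y)\<^sup>2"
      using upper_estimate_of_subgradients[OF sub lip z(1,2)] by simp
    have 3: "\<beta> \<bullet> (?z + y) = \<beta> \<bullet> ?z + p a \<bullet> y"
      unfolding \<beta>_def by (simp add: inner_simps y)
    have 4: "(norm (t *\<^sub>R h + y))\<^sup>2 = t\<^sup>2 + (norm y)\<^sup>2"
      unfolding power2_norm_eq_inner
      by (simp add: inner_simps hh y inner_commute[of y h] power2_eq_square)
    have 5: "(norm (t *\<^sub>R h))\<^sup>2 = t\<^sup>2" by (simp add: h power2_eq_square)
    show ?thesis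
      unfolding D_def using 1 2 3
      by (simp add: add.assoc inner_simps hh y 4 5[simplified] h) (simp add: algebra_simps)
  qed
  \<comment> \<open>By \<open>slow\<close>, the outward end slopes exceed \<open>m\<close> in that
    direction by less than c l / 2. Moving inwards by l / 4, the linear terms raise \<open>D\<close>
    by less than c l^2 / 8, while the quadratic term drops by 3 c l^2 / 16.\<close>
  have along: "D (a + (\<sigma> * (l / 4)) *\<^sub>R h) < D (a + (\<sigma> * (l / 2)) *\<^sub>R h) - c * l\<^sup>2 / 16" if "\<bar>\<sigma>\<bar> = 1" for \<sigma>
  proof -
    let ?z = "a + (\<sigma> * (l / 2)) *\<^sub>R h" and ?z' = "a + (\<sigma> * (l / 4)) *\<^sub>R h"
    have s: "\<sigma> = 1 \<or> \<sigma> = -1" using that by auto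
    then have ss: "\<sigma> * (\<sigma> * x) = x" for x by auto
    have z: "?z \<in> S" "?z' \<in> S"
      using that h l by (auto intro!: subsetD[OF S] simp: dist_norm abs_mult)
    have "?z' - ?z = (- \<sigma> * l / 4) *\<^sub>R h"
      by (simp add: algebra_simps flip: scaleR_left_diff_distrib)
    then have "\<psi> ?z' \<ge> \<psi> ?z - (\<sigma> * l / 4) * (p ?z \<bullet> h)"
      using sub[OF z] by simp
    moreover have "\<sigma> * (p ?z \<bullet> h - m) < c * l / 2"
      using s slow unfolding m_def by (auto simp: inner_simps field_simps)
    then have "(l / 4) * (\<sigma> * (p ?z \<bullet> h - m)) < (l / 4) * (c * l / 2)"
      using l by (intro mult_strict_left_mono) auto
    moreover have "\<beta> \<bullet> h = m" unfolding \<beta>_def by (simp add: inner_simps hh)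
    ultimately show ?thesis
      unfolding D_def by (simp add: inner_simps hh h power2_eq_square algebra_simps ss)
  qed
  define C where "C = {z. \<bar>h \<bullet> (z - a)\<bar> \<le> l / 2 \<and> norm (z - a - (h \<bullet> (z - a)) *\<^sub>R h) \<le> l}"
  define C' where "C' = {z. \<bar>h \<bullet> (z - a)\<bar> < l / 2 \<and> norm (z - a - (h \<bullet> (z - a)) *\<^sub>R h) < l}"
  have ball: "C \<subseteq> ball a (2 * l)"
  proof
    fix z assume "z \<in> C"
    then have "norm ((h \<bullet> (z - a)) *\<^sub>R h) \<le> l / 2" "norm (z - a - (h \<bullet> (z - a)) *\<^sub>R h) \<le> l"
      using h by (auto simp: C_def)
    then show "z \<in> ball a (2 * l)"
      using norm_triangle_ineq[of "z - a - (h \<bullet> (z - a)) *\<^sub>R h" "(h \<bullet> (z - a)) *\<^sub>R h"] l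
      by (simp add: dist_norm norm_minus_commute)
  qed
  have cont: "continuous_on C D"
  proof -
    have "continuous_on S \<psi>"
      by (rule has_derivative_continuous_on[OF has_derivative_of_subgradients[OF sub lip]])
    then have "continuous_on C \<psi>"
      by (rule continuous_on_subset) (use S ball ball_subset_cball in blast)
    then show ?thesis
      unfolding D_def by (intro continuous_intros)
  qed
  have "closed C"
    unfolding C_def by (intro closed_Collect_conj closed_Collect_le continuous_intros)
  moreover have "bounded C" using ball bounded_subset bounded_ball by blast
  moreover have "a \<in> C" unfolding C_def using l by simp
  ultimately obtain z0 where z0: "z0 \<in> C" and min: "\<And>z. z \<in> C \<Longrightarrow> D z0 \<le> D z"
    using continuous_attains_inf[OF _ _ cont] by (metis compact_eq_bounded_closed empty_iff)
  define t where "t = h \<bullet> (z0 - a)"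
  define y where "y = z0 - a - t *\<^sub>R h"
  have z0_eq: "z0 = a + t *\<^sub>R h + y" unfolding y_def by simp
  have ty: "\<bar>t\<bar> \<le> l / 2" "norm y \<le> l" "h \<bullet> y = 0"
    using z0 unfolding C_def t_def y_def by (auto simp: inner_simps hh)
  note lower = across[OF ty(1,3,2), folded z0_eq]
  have axis: "a + \<tau> *\<^sub>R h \<in> C" if "\<bar>\<tau>\<bar> \<le> l / 2" for \<tau>
    using that l unfolding C_def by (simp add: hh)
  \<comment> \<open>On the lateral boundary the gain (K - L) l^2 > L l^2 exceeds the possible loss L
    l^2 / 2, so the axis point would have a smaller value.\<close>
  have "norm y < l"
  proof (rule ccontr)
    assume "\<not> norm y < l"
    then have yl: "norm y = l" using ty by simp
    have "L * \<bar>t\<bar> * l \<le> L * (l / 2) * l"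
      using ty(1) L l by (intro mult_right_mono mult_left_mono) auto
    moreover have "(2 * L - L) * l\<^sup>2 < (K - L) * l\<^sup>2"
      using K l by (intro mult_strict_right_mono) auto
    moreover have "0 < L * l\<^sup>2" using L l by simp
    ultimately have "(K - L) * (norm y)\<^sup>2 - L * \<bar>t\<bar> * norm y > 0"
      unfolding yl by (simp add: power2_eq_square algebra_simps)
    then show False
      using lower min[OF axis[OF ty(1)]] by simp
  qed
  \<comment> \<open>On an end cap, leaving the axis lowers \<open>D\<close> by at most L^2 l^2 / (16
    (K - L)), as completing the square shows. This is below c l^2 / 16, which moving inwards on the
    axis gains.\<close>
  moreover have "\<bar>t\<bar> < l / 2"
  proof (rule ccontr)
    assume "\<not> \<bar>t\<bar> < l / 2"
    then have tl: "\<bar>t\<bar> = l / 2" using ty by simp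
    define \<sigma> where "\<sigma> = sgn t"
    have \<sigma>: "\<bar>\<sigma>\<bar> = 1" "t = \<sigma> * (l / 2)"
      using tl l unfolding \<sigma>_def by (auto simp: sgn_if abs_if split: if_splits)
    have "\<bar>\<sigma> * (l / 4)\<bar> \<le> l / 2" using \<sigma>(1) l by (simp add: abs_mult)
    then have "D z0 < D (a + t *\<^sub>R h) - c * l\<^sup>2 / 16"
      using min[OF axis] along[OF \<sigma>(1)] unfolding \<sigma>(2) by (meson le_less_trans)
    moreover have "(K - L) * (norm y)\<^sup>2 - L * (l / 2) * norm y \<ge> - (c * l\<^sup>2 / 16)"
    proof -
      have KL: "K - L > 0" using K L by simp
      have "0 \<le> (4 * (K - L) * norm y - L * l)\<^sup>2" by simp
      then have "0 \<le> 16 * (K - L) * ((K - L) * (norm y)\<^sup>2 - L * (l / 2) * norm y) + L\<^sup>2 * l\<^sup>2"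
        by (simp add: power2_eq_square algebra_simps)
      also have "\<dots> \<le> 16 * (K - L) * ((K - L) * (norm y)\<^sup>2 - L * (l / 2) * norm y) + (c * (K - L)) * l\<^sup>2"
        using K(2) by (intro add_left_mono mult_right_mono) auto
      also have "\<dots> = 16 * (K - L) * ((K - L) * (norm y)\<^sup>2 - L * (l / 2) * norm y + c * l\<^sup>2 / 16)"
        by (simp add: field_simps)
      finally show ?thesis using KL by (simp add: zero_le_mult_iff)
    qed
    ultimately show False using lower tl by simp
  qed
  ultimately have "z0 \<in> C'" unfolding C'_def t_def y_def by simp
  have "open C'"
    unfolding C'_def by (intro open_Collect_conj open_Collect_less continuous_intros)
  then have "\<forall>\<^sub>F s in nhds 0. z0 + s \<in> C'"
    using \<open>z0 \<in> C'\<close> by (intro topological_tendstoD[where l=z0]) (auto intro!: tendsto_eq_intros filterlim_ident)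
  then have near: "\<forall>\<^sub>F s in nhds 0. z0 + s \<in> S \<and> D z0 \<le> D (z0 + s)"
  proof eventually_elim
    case (elim s)
    then have "z0 + s \<in> C" unfolding C_def C'_def by auto
    then show ?case using min ball S ball_subset_cball by blast
  qed
  \<comment> \<open>The gradient at \<open>z0\<close> of the quadratic part of
    \<open>D\<close>.\<close>
  define G where "G = \<beta> + (2 * c * (h \<bullet> (z0 - a))) *\<^sub>R h + (2 * K) *\<^sub>R (z0 - a - (h \<bullet> (z0 - a)) *\<^sub>R h)"
  have upper: "\<forall>\<^sub>F s in nhds 0. z0 + s \<in> S \<and>
      \<psi> (z0 + s) \<le> \<psi> z0 + G \<bullet> s + c * (h \<bullet> s)\<^sup>2 + K * ((norm s)\<^sup>2 - (h \<bullet> s)\<^sup>2)"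
    using near
  proof eventually_elim
    case (elim s)
    have "z0 + s - a = (z0 - a) + s" by simp
    then have "D (z0 + s) - D z0 = \<psi> z0 + G \<bullet> s + c * (h \<bullet> s)\<^sup>2 + K * ((norm s)\<^sup>2 - (h \<bullet> s)\<^sup>2) - \<psi> (z0 + s)"
      unfolding D_def G_def power2_norm_eq_inner
      by (simp only: inner_add_left inner_add_right power2_sum inner_diff_left inner_diff_right
          inner_scaleR_left)
        (simp add: algebra_simps inner_commute)
    then show ?case using elim by simp
  qed
  have "z0 \<in> S" using z0 ball S ball_subset_cball by blast
  \<comment> \<open>Comparing the subgradient inequality with the upper bound along the direction
    \<open>e\<close> itself forces \<open>e = 0\<close>, so the touching quadratic has gradient
    \<open>p z0\<close>.\<close>
  define e where "e = p z0 - G"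
  have "0 \<le> - (e \<bullet> e)"
  proof (rule nonneg_of_quadratic_expansion)
    have "filterlim (\<lambda>\<tau>. \<tau> *\<^sub>R e) (nhds 0) (at_right (0::real))"
      by (auto intro!: tendsto_eq_intros)
    from eventually_compose_filterlim[OF upper this]
    show "\<forall>\<^sub>F \<tau> in at_right 0. 0 \<le> \<tau> * - (e \<bullet> e) + \<tau>\<^sup>2 * (c * (h \<bullet> e)\<^sup>2 + K * ((norm e)\<^sup>2 - (h \<bullet> e)\<^sup>2))"
    proof eventually_elim
      case (elim \<tau>)
      have "p z0 \<bullet> (\<tau> *\<^sub>R e) \<le> G \<bullet> (\<tau> *\<^sub>R e) + c * (h \<bullet> (\<tau> *\<^sub>R e))\<^sup>2
          + K * ((norm (\<tau> *\<^sub>R e))\<^sup>2 - (h \<bullet> (\<tau> *\<^sub>R e))\<^sup>2)"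
        using sub[OF \<open>z0 \<in> S\<close>, of "z0 + \<tau> *\<^sub>R e"] elim by simp
      moreover have "p z0 \<bullet> (\<tau> *\<^sub>R e) - G \<bullet> (\<tau> *\<^sub>R e) = \<tau> * (e \<bullet> e)"
        unfolding e_def by (simp add: inner_diff_left algebra_simps)
      ultimately show ?case
        by (simp add: power_mult_distrib algebra_simps)
    qed
  qed
  then have "e \<bullet> e = 0" using inner_ge_zero[of e] by linarith
  then have "G = p z0" unfolding e_def by simp
  show ?thesis
  proof (rule that)
    show "z0 \<in> ball a (2 * l)" using z0 ball by blast
    show "\<forall>\<^sub>F s in nhds 0. \<psi> (z0 + s) \<le> \<psi> z0 + p z0 \<bullet> s + c * (h \<bullet> s)\<^sup>2
        + K * ((norm s)\<^sup>2 - (h \<bullet> s)\<^sup>2)"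
      using upper unfolding \<open>G = p z0\<close> by (rule eventually_mono) simp
  qed
qed

section \<open>Tilted minimisers\<close>

text \<open>Tilt stability on a fixed radius with its witnesses named. A positive \<open>L\<close>
  allows radii such as \<open>\<rho> / L\<close>.\<close>

locale tilt_selection =
  fixes f :: "real^'n \<Rightarrow> ereal" and xbar :: "real^'n" and \<rho> \<eta> L :: real and m :: "real^'n \<Rightarrow> real^'n"
  assumes not_minus_infinity: "\<And>x. f x \<noteq> -\<infinity>" and finite_xbar: "\<bar>f xbar\<bar> \<noteq> \<infinity>"
    and radii: "\<rho> > 0" "\<eta> > 0"
    and argmin: "\<And>z. z \<in> ball 0 \<eta> \<Longrightarrow> argmin_set (\<lambda>x. f x - ereal (x \<bullet> z)) (cball xbar \<rho>) = {m z}"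
    and lipschitz: "L-lipschitz_on (ball 0 \<eta>) m" and m_0: "m 0 = xbar" and L_pos: "L > 0"
begin

text \<open>On \<open>ball 0 \<eta>\<close> the conversion to reals loses nothing, by
  \<open>f_m\<close>.\<close>

definition val :: "real^'n \<Rightarrow> real" where
  "val z = real_of_ereal (f (m z))"

text \<open>On \<open>ball 0 \<eta>\<close> this is the convex conjugate of \<open>f\<close> restricted to \<open>cball xbar \<rho>\<close>.\<close>

definition conjugate :: "real^'n \<Rightarrow> real" where
  "conjugate z = m z \<bullet> z - val z"

lemma m_argmin:
  assumes "z \<in> ball 0 \<eta>"
  shows "m z \<in> cball xbar \<rho>"
    and "x \<in> cball xbar \<rho> \<Longrightarrow> f (m z) - ereal (m z \<bullet> z) \<le> f x - ereal (x \<bullet> z)"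
  using argmin[OF assms] unfolding argmin_set_def is_arg_min_def by (auto simp: not_less)

text \<open>Comparison of the minimiser with \<open>xbar\<close>, where \<open>f\<close> is finite,
  excludes the value \<infinity>.\<close>

lemma f_m:
  assumes "z \<in> ball 0 \<eta>" shows "f (m z) = ereal (val z)"
  using m_argmin(2)[OF assms, of xbar] radii finite_xbar not_minus_infinity[of "m z"]
  unfolding val_def by (cases "f (m z)"; cases "f xbar") auto

lemma support:
  assumes z: "z \<in> ball 0 \<eta>" and x: "x \<in> cball xbar \<rho>"
  shows "ereal (val z + z \<bullet> (x - m z)) \<le> f x"
  using m_argmin(2)[OF z x] not_minus_infinity[of x] f_m[OF z]
  by (cases "f x") (auto simp: inner_simps inner_commute)

text \<open>Contact with the supporting affine function makes \<open>x\<close> another tilted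
  minimiser, and the argmin is a singleton. This later gives uniqueness of \<open>v\<close>.\<close>

lemma support_unique:
  assumes z: "z \<in> ball 0 \<eta>" and x: "x \<in> cball xbar \<rho>"
    and le: "f x \<le> ereal (val z + z \<bullet> (x - m z))"
  shows "x = m z"
proof -
  have "f x - ereal (x \<bullet> z) \<le> f (m z) - ereal (m z \<bullet> z)"
    using le f_m[OF z] by (cases "f x") (auto simp: inner_simps inner_commute)
  then have "x \<in> argmin_set (\<lambda>x. f x - ereal (x \<bullet> z)) (cball xbar \<rho>)"
    unfolding argmin_set_def is_arg_min_def mem_Collect_eq
    using x m_argmin(2)[OF z] by (auto simp: not_less intro: order_trans)
  then show ?thesis using argmin[OF z] by simp
qed

text \<open>The support inequality of the tilt \<open>z'\<close> at the point \<open>m z\<close>.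
  With the Lipschitz bound it makes \<open>m\<close> the gradient of
  \<open>conjugate\<close>.\<close>

lemma conjugate_subgradient:
  assumes "z \<in> ball 0 \<eta>" "z' \<in> ball 0 \<eta>"
  shows "conjugate z + m z \<bullet> (z' - z) \<le> conjugate z'"
  using support[OF assms(2) m_argmin(1)[OF assms(1)]] f_m[OF assms(1)]
  unfolding conjugate_def by (simp add: inner_simps inner_commute)

lemma dist_m_xbar:
  assumes "z \<in> ball 0 \<eta>" shows "norm (m z - xbar) \<le> L * norm z"
  using lipschitz_onD[OF lipschitz assms, of 0] radii m_0 by (simp add: dist_norm)

text \<open>Limiting subjets require convergence of the values of \<open>f\<close> too, although
  \<open>f\<close> may be discontinuous. Supporting at tilt \<open>0\<close> and at tilt
  \<open>Z k\<close> squeezes these values.\<close>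

lemma tendsto_m:
  assumes Z: "Z \<longlonglongrightarrow> 0" "\<And>k. Z k \<in> ball 0 \<eta>"
  shows "(\<lambda>k. m (Z k)) \<longlonglongrightarrow> xbar" and "(\<lambda>k. f (m (Z k))) \<longlonglongrightarrow> f xbar"
proof -
  show lim: "(\<lambda>k. m (Z k)) \<longlonglongrightarrow> xbar"
  proof (rule Lim_null_comparison[THEN LIM_zero_cancel])
    show "\<forall>\<^sub>F k in sequentially. norm (m (Z k) - xbar) \<le> L * norm (Z k)"
      using dist_m_xbar[OF Z(2)] by simp
    show "(\<lambda>k. L * norm (Z k)) \<longlonglongrightarrow> 0"
      using tendsto_mult_right_zero[OF tendsto_norm_zero[OF Z(1)]] .
  qed
  have "0 \<in> ball (0::real^'n) \<eta>" using radii by simp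
  note f0 = f_m[OF this, unfolded m_0]
  have "(\<lambda>k. val 0 + Z k \<bullet> (m (Z k) - xbar)) \<longlonglongrightarrow> val 0 + 0 \<bullet> (xbar - xbar)"
    by (intro tendsto_intros Z lim)
  then have up: "(\<lambda>k. val 0 + Z k \<bullet> (m (Z k) - xbar)) \<longlonglongrightarrow> val 0" by simp
  have "(\<lambda>k. val (Z k)) \<longlonglongrightarrow> val 0"
  proof (rule tendsto_sandwich[OF _ _ tendsto_const up])
    show "\<forall>\<^sub>F k in sequentially. val 0 \<le> val (Z k)"
      using support[OF \<open>0 \<in> ball 0 \<eta>\<close> m_argmin(1)[OF Z(2)]] f_m[OF Z(2)] by simp
    show "\<forall>\<^sub>F k in sequentially. val (Z k) \<le> val 0 + Z k \<bullet> (m (Z k) - xbar)"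
      using support[OF Z(2), of xbar] radii f0 by (simp add: inner_diff_right algebra_simps)
  qed
  then show "(\<lambda>k. f (m (Z k))) \<longlonglongrightarrow> f xbar"
    using f_m[OF Z(2)] f0 by simp
qed

text \<open>The supporting affine functions of \<open>f\<close> at the tilts \<open>z + s\<close> are combined by choosing, for each
  \<open>y\<close>, the maximiser \<open>s = Q *v (y - m z)\<close> of \<open>s \<bullet> (y - m z)\<close> minus the quadratic bound.\<close>

lemma subjet_of_upper_quadratic:
  assumes z: "z \<in> ball 0 \<eta>" and mz: "m z \<in> ball xbar \<rho>" and h: "norm h = 1"
    and c: "c > 0" and K: "K > 0"
    and upper: "\<forall>\<^sub>F s in nhds 0.
      conjugate (z + s) \<le> conjugate z + m z \<bullet> s + c * (h \<bullet> s)\<^sup>2 + K * ((norm s)\<^sup>2 - (h \<bullet> s)\<^sup>2)"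
  shows "(z, rank1_matrix (1 / (2 * c) - 1 / (2 * K)) h (1 / (2 * K))) \<in> subjet f (m z)"
proof (rule subjet_quadraticI[OF _ transpose_rank1_matrix])
  \<comment> \<open>The inverse of the Hessian of the upper quadratic, which is 2 c along
    \<open>h\<close> and 2 K across.\<close>
  define Q where "Q = rank1_matrix (1 / (2 * c) - 1 / (2 * K)) h (1 / (2 * K))"
  have hh: "h \<bullet> h = 1" using h by (simp add: norm_eq_1)
  have "((\<lambda>y. Q *v (y - m z)) \<longlongrightarrow> Q *v (m z - m z)) (nhds (m z))"
    by (intro bounded_linear.tendsto[OF matrix_vector_mul_bounded_linear] tendsto_intros filterlim_ident)
  then have lim: "filterlim (\<lambda>y. Q *v (y - m z)) (nhds 0) (nhds (m z))" by simp
  have "\<forall>\<^sub>F s in nhds 0. z + s \<in> ball 0 \<eta>"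
    using z by (intro topological_tendstoD[where l=z]) (auto intro!: tendsto_eq_intros filterlim_ident)
  with upper have "\<forall>\<^sub>F s in nhds 0. z + s \<in> ball 0 \<eta> \<and>
      conjugate (z + s) \<le> conjugate z + m z \<bullet> s + c * (h \<bullet> s)\<^sup>2 + K * ((norm s)\<^sup>2 - (h \<bullet> s)\<^sup>2)"
    by eventually_elim auto
  from eventually_compose_filterlim[OF this lim] eventually_nhds_in_open[OF open_ball mz]
  have "\<forall>\<^sub>F y in nhds (m z). f (m z) + ereal (z \<bullet> (y - m z) + (Q *v (y - m z)) \<bullet> (y - m z) / 2) \<le> f y"
  proof eventually_elim
    case (elim y)
    define w where "w = y - m z"
    define s where "s = Q *v w"
    define \<alpha> where "\<alpha> = 1 / (2 * c)"
    define \<kappa> where "\<kappa> = 1 / (2 * K)"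
    have s_eq: "s = ((\<alpha> - \<kappa>) * (h \<bullet> w)) *\<^sub>R h + \<kappa> *\<^sub>R w"
      unfolding s_def Q_def \<alpha>_def \<kappa>_def by (rule rank1_matrix_mult)
    have hs: "h \<bullet> s = \<alpha> * (h \<bullet> w)"
      unfolding s_eq by (simp add: inner_simps hh algebra_simps)
    have ss: "(norm s)\<^sup>2 = (\<alpha> * (h \<bullet> w))\<^sup>2 + \<kappa>\<^sup>2 * (w \<bullet> w - (h \<bullet> w)\<^sup>2)"
      unfolding s_eq power2_norm_eq_inner
      by (simp add: inner_simps hh power2_eq_square inner_commute[of w h] algebra_simps)
    have sw: "s \<bullet> w = \<alpha> * (h \<bullet> w)\<^sup>2 + \<kappa> * (w \<bullet> w - (h \<bullet> w)\<^sup>2)"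
      unfolding s_eq by (simp add: inner_simps power2_eq_square algebra_simps)
    have "c * \<alpha>\<^sup>2 = \<alpha> / 2" "K * \<kappa>\<^sup>2 = \<kappa> / 2"
      unfolding \<alpha>_def \<kappa>_def using c K by (auto simp: power2_eq_square field_simps)
    then have half: "c * (\<alpha>\<^sup>2 * q) = \<alpha> * q / 2" "K * (\<kappa>\<^sup>2 * q) = \<kappa> * q / 2" for q
      by (metis mult.assoc times_divide_eq_left)+
    \<comment> \<open>At the maximising \<open>s\<close> the quadratic takes up half of the linear
      term \<open>s \<bullet> w\<close>; the other half is the second-order term of the
      minorant.\<close>
    have "c * (h \<bullet> s)\<^sup>2 + K * ((norm s)\<^sup>2 - (h \<bullet> s)\<^sup>2)
        = c * (\<alpha>\<^sup>2 * (h \<bullet> w)\<^sup>2) + K * (\<kappa>\<^sup>2 * (w \<bullet> w - (h \<bullet> w)\<^sup>2))"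
      unfolding hs ss by (simp add: power_mult_distrib)
    then have val: "c * (h \<bullet> s)\<^sup>2 + K * ((norm s)\<^sup>2 - (h \<bullet> s)\<^sup>2) = s \<bullet> w / 2"
      unfolding half sw by (simp add: add_divide_distrib)
    have "val z + z \<bullet> w + s \<bullet> w / 2 \<le> val (z + s) + (z + s) \<bullet> (y - m (z + s))"
    proof -
      have "conjugate (z + s) \<le> conjugate z + m z \<bullet> s + s \<bullet> w / 2"
        using elim(1) val unfolding w_def[symmetric] s_def[symmetric] by linarith
      moreover have "s \<bullet> w = s \<bullet> y - m z \<bullet> s" "z \<bullet> w = z \<bullet> y - m z \<bullet> z"
        unfolding w_def by (simp_all add: inner_diff_right inner_commute)
      moreover have "(z + s) \<bullet> (y - m (z + s)) = z \<bullet> y + s \<bullet> y - m (z + s) \<bullet> (z + s)"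
        by (simp add: inner_simps inner_commute)
      ultimately show ?thesis
        unfolding conjugate_def by linarith
    qed
    then have "ereal (val z + (z \<bullet> w + s \<bullet> w / 2)) \<le> ereal (val (z + s) + (z + s) \<bullet> (y - m (z + s)))"
      by simp
    also have "\<dots> \<le> f y"
      using elim unfolding w_def[symmetric] s_def[symmetric] by (intro support) auto
    finally show ?case
      unfolding f_m[OF z] w_def[symmetric] s_def[symmetric] by simp
  qed
  then show "\<forall>\<^sub>F y in nhds (m z). f (m z) + ereal (z \<bullet> (y - m z) +
      (rank1_matrix (1 / (2 * c) - 1 / (2 * K)) h (1 / (2 * K)) *v (y - m z)) \<bullet> (y - m z) / 2) \<le> f y"
    unfolding Q_def .
qed (simp add: f_m[OF z])

section \<open>From slow growth of the minimisers to strong monotonicity\<close>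

text \<open>Slow growth at every scale gives touching quadratics at tilts tending to 0, with the
  same \<open>c\<close> and \<open>K\<close> throughout. Only the unit direction varies, and the
  unit sphere of \<open>U\<close> is compact.\<close>

lemma limiting_subhessian_of_slow_growth:
  assumes U: "subspace U" and c: "c > 0" and K: "K > 2 * L" "c * (K - L) > L\<^sup>2"
    and slow: "\<And>\<sigma>. 0 < \<sigma> \<Longrightarrow> \<sigma> \<le> \<eta> \<Longrightarrow> \<exists>z1 \<in> U \<inter> ball 0 \<sigma>. \<exists>z2 \<in> U \<inter> ball 0 \<sigma>.
      (m z1 - m z2) \<bullet> (z1 - z2) < c * (norm (z1 - z2))\<^sup>2"
  obtains h where "h \<in> U" "norm h = 1"
    "rank1_matrix (1 / (2 * c) - 1 / (2 * K)) h (1 / (2 * K)) \<in> limiting_subhessians f xbar 0"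
proof -
  let ?Q = "\<lambda>h. rank1_matrix (1 / (2 * c) - 1 / (2 * K)) h (1 / (2 * K))"
  \<comment> \<open>The bound \<open>\<rho> / L\<close> keeps \<open>m z\<close> in the open ball
    about \<open>xbar\<close> when \<open>norm z < \<kappa>\<close>.\<close>
  define \<kappa> where "\<kappa> = min \<eta> (\<rho> / L)"
  have \<kappa>: "\<kappa> > 0" "\<kappa> \<le> \<eta>" "L * \<kappa> \<le> \<rho>"
    using radii L_pos unfolding \<kappa>_def by (auto simp: min_def field_simps)
  have "\<exists>h z. h \<in> U \<and> norm h = 1 \<and> norm z < \<tau> \<and> (z, ?Q h) \<in> subjet f (m z)"
    if \<tau>: "0 < \<tau>" "\<tau> \<le> \<kappa>" for \<tau>
  proof -
    obtain z1 z2 where z: "z1 \<in> U" "z2 \<in> U" "norm z1 < \<tau> / 5" "norm z2 < \<tau> / 5"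
      and sl: "(m z1 - m z2) \<bullet> (z1 - z2) < c * (norm (z1 - z2))\<^sup>2"
      \<comment> \<open>The midpoint has norm below \<tau> / 5 and the length \<open>l\<close> is
        below 2 \<tau> / 5, so the ball of radius \<open>2 * l\<close> about the midpoint stays
        within norm \<tau>.\<close>
      using slow[of "\<tau> / 5"] \<tau> \<kappa> by auto
    define l where "l = norm (z1 - z2)"
    define h where "h = (z1 - z2) /\<^sub>R l"
    define a where "a = (1 / 2) *\<^sub>R (z1 + z2)"
    have l: "l > 0" using sl unfolding l_def by (cases "z1 = z2") auto
    then have h: "norm h = 1" "h \<in> U"
      using z subspace_diff[OF U] subspace_scale[OF U] unfolding h_def l_def by auto
    have lh: "z1 - z2 = l *\<^sub>R h" unfolding h_def using l by simp
    have ends: "a + (l / 2) *\<^sub>R h = z1" "a - (l / 2) *\<^sub>R h = z2"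
    proof -
      have half: "(l / 2) *\<^sub>R h = (1 / 2) *\<^sub>R (z1 - z2)" by (simp add: lh)
      show "a + (l / 2) *\<^sub>R h = z1" "a - (l / 2) *\<^sub>R h = z2"
        unfolding a_def half by (auto simp: vec_eq_iff field_simps)
    qed
    have "norm a < \<tau> / 5"
      using norm_triangle_ineq[of z1 z2] z unfolding a_def by simp
    moreover have "l < 2 * \<tau> / 5"
      using norm_triangle_ineq4[of z1 z2] z unfolding l_def by simp
    ultimately have near: "norm y < \<tau>" if "y \<in> cball a (2 * l)" for y
      using that norm_triangle_ineq[of a "y - a"] by (simp add: dist_norm norm_minus_commute)
    have "l * ((m z1 - m z2) \<bullet> h) < l * (c * l)"
      using sl unfolding l_def[symmetric] lh using h(1) l by (simp add: power2_eq_square mult_ac)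
    then have slow': "(m (a + (l / 2) *\<^sub>R h) - m (a - (l / 2) *\<^sub>R h)) \<bullet> h < c * l"
      unfolding ends using l by simp
    have "cball a (2 * l) \<subseteq> ball 0 \<eta>"
      using near \<tau> \<kappa> by force
    then obtain z0 where z0: "z0 \<in> ball a (2 * l)"
      and upper: "\<forall>\<^sub>F s in nhds 0. conjugate (z0 + s) \<le> conjugate z0 + m z0 \<bullet> s + c * (h \<bullet> s)\<^sup>2
          + K * ((norm s)\<^sup>2 - (h \<bullet> s)\<^sup>2)"
      using upper_quadratic_touching[OF conjugate_subgradient lipschitz L_pos c K h(1) l _ slow']
      by blast
    have nz: "norm z0 < \<tau>" using near z0 by auto
    then have zb: "z0 \<in> ball 0 \<eta>" using \<tau> \<kappa> by simp
    have "norm (m z0 - xbar) < \<rho>"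
    proof -
      have "L * norm z0 < L * \<kappa>" using nz \<tau> L_pos by simp
      then show ?thesis using dist_m_xbar[OF zb] \<kappa>(3) by linarith
    qed
    then have "m z0 \<in> ball xbar \<rho>" by (simp add: dist_norm norm_minus_commute)
    then have "(z0, ?Q h) \<in> subjet f (m z0)"
      using K L_pos by (intro subjet_of_upper_quadratic zb h c upper) auto
    then show ?thesis using h nz by blast
  qed
  then have "\<exists>h z. h \<in> U \<and> norm h = 1 \<and> norm z < \<kappa> / real (Suc k) \<and> (z, ?Q h) \<in> subjet f (m z)" for k
  proof -
    have "0 < \<kappa> / real (Suc k)" "\<kappa> / real (Suc k) \<le> \<kappa>" using \<kappa> by (simp_all add: field_simps)
    then show ?thesis by fact
  qed
  then obtain H Z where HZ: "\<And>k. H k \<in> U" "\<And>k. norm (H k) = 1" "\<And>k. norm (Z k) < \<kappa> / real (Suc k)"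
      "\<And>k. (Z k, ?Q (H k)) \<in> subjet f (m (Z k))"
    by metis
  have "compact (U \<inter> sphere 0 1)"
    using closed_subspace[OF U] by (simp add: closed_Int_compact)
  moreover have "\<forall>k. H k \<in> U \<inter> sphere 0 1" using HZ by simp
  ultimately obtain h r where h: "h \<in> U \<inter> sphere 0 1" and r: "strict_mono r" "(H \<circ> r) \<longlonglongrightarrow> h"
    unfolding compact_def by metis
  have "(\<lambda>k. norm (Z k)) \<longlonglongrightarrow> 0"
  proof (rule tendsto_sandwich[OF _ _ tendsto_const])
    show "(\<lambda>k. \<kappa> / real (Suc k)) \<longlonglongrightarrow> 0"
      by (intro LIMSEQ_Suc[OF lim_const_over_n])
    show "\<forall>\<^sub>F k in sequentially. norm (Z k) \<le> \<kappa> / real (Suc k)"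
      using less_imp_le[OF HZ(3)] by (rule always_eventually[OF allI])
  qed simp
  then have "Z \<longlonglongrightarrow> 0" by (rule tendsto_norm_zero_cancel)
  then have Zr: "(Z \<circ> r) \<longlonglongrightarrow> 0" using r(1) by (rule LIMSEQ_subseq_LIMSEQ)
  have "norm (Z k) < \<eta>" for k
  proof -
    have "\<kappa> / real (Suc k) \<le> \<kappa>" using \<kappa> by (simp add: field_simps)
    then show ?thesis using HZ(3)[of k] \<kappa>(2) by linarith
  qed
  then have Zb: "(Z \<circ> r) k \<in> ball 0 \<eta>" for k by simp
  have "(\<lambda>k. ((Z \<circ> r) k, ?Q ((H \<circ> r) k))) \<longlonglongrightarrow> (0, ?Q h)"
    by (intro tendsto_Pair Zr tendsto_rank1_matrix r)
  then have "(0, ?Q h) \<in> limiting_subjet f xbar"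
    unfolding limiting_subjet_def using tendsto_m[OF Zr Zb] HZ(4) by fastforce
  then have "?Q h \<in> limiting_subhessians f xbar 0"
    unfolding limiting_subhessians_def by (simp add: transpose_rank1_matrix)
  then show ?thesis using that[of h] h by simp
qed

text \<open>Otherwise some limiting subhessian has curvature \<open>M\<close> along a unit vector
  \<open>h\<close> of \<open>U2\<close>. Summed over an orthonormal basis, its values give at least
  \<open>M\<close>, more than the sum of the finite bounds on the basis vectors.\<close>

lemma strongly_monotone_on_U2:
  assumes U: "subspace (U2 f xbar)"
  obtains c \<sigma> where "c > 0" "\<sigma> > 0" "\<sigma> \<le> \<eta>"
    "\<And>z1 z2. z1 \<in> U2 f xbar \<inter> ball 0 \<sigma> \<Longrightarrow> z2 \<in> U2 f xbar \<inter> ball 0 \<sigma>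
      \<Longrightarrow> c * (norm (z1 - z2))\<^sup>2 \<le> (m z1 - m z2) \<bullet> (z1 - z2)"
proof -
  define A where "A = limiting_subhessians f xbar 0"
  obtain B where B: "B \<subseteq> U2 f xbar" "pairwise orthogonal B" "\<And>b. b \<in> B \<Longrightarrow> norm b = 1"
      "independent B" "span B = U2 f xbar"
    using orthonormal_basis_subspace[OF U] by metis
  have finB: "finite B" using B(4) independent_imp_finite by blast
  have "\<exists>R. q_support A b \<le> ereal R" if "b \<in> B" for b
    using B(1) that unfolding U2_def dom_q_def A_def[symmetric]
    by (cases "q_support A b") auto
  then obtain R where R: "\<And>b. b \<in> B \<Longrightarrow> q_support A b \<le> ereal (R b)" by metis
  define M where "M = (\<Sum>b\<in>B. \<bar>R b\<bar>) + 1"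
  have M: "M > 0" unfolding M_def by (simp add: add_nonneg_pos sum_nonneg)
  \<comment> \<open>Chosen so that the curvature 1 / (2 c) of the subhessian along \<open>h\<close>
    is \<open>M\<close>.\<close>
  define c where "c = 1 / (2 * M)"
  have c: "c > 0" unfolding c_def using M by simp
  define K where "K = 2 * L + L\<^sup>2 / c + 1"
  have K: "K > 2 * L" "c * (K - L) > L\<^sup>2"
    unfolding K_def using c L_pos by (auto simp: algebra_simps add_nonneg_pos intro!: add_pos_pos)
  have "\<exists>\<sigma>. 0 < \<sigma> \<and> \<sigma> \<le> \<eta> \<and> (\<forall>z1 \<in> U2 f xbar \<inter> ball 0 \<sigma>. \<forall>z2 \<in> U2 f xbar \<inter> ball 0 \<sigma>.
      c * (norm (z1 - z2))\<^sup>2 \<le> (m z1 - m z2) \<bullet> (z1 - z2))"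
  proof (rule ccontr)
    assume "\<not> ?thesis"
    then obtain h where h: "h \<in> U2 f xbar" "norm h = 1"
      and hA: "rank1_matrix (1 / (2 * c) - 1 / (2 * K)) h (1 / (2 * K)) \<in> A"
      using limiting_subhessian_of_slow_growth[OF U c K] unfolding A_def by (metis not_le)
    have "M * (h \<bullet> b)\<^sup>2 \<le> \<bar>R b\<bar>" if b: "b \<in> B" for b
    proof -
      have "(h \<bullet> b)\<^sup>2 \<le> 1"
        using Cauchy_Schwarz_ineq2[of h b] h(2) B(3)[OF b] by (simp add: abs_square_le_1)
      then have "0 \<le> (1 / (2 * K)) * (1 - (h \<bullet> b)\<^sup>2)" using K(1) L_pos by simp
      moreover have "(rank1_matrix (1 / (2 * c) - 1 / (2 * K)) h (1 / (2 * K)) *v b) \<bullet> b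
          = M * (h \<bullet> b)\<^sup>2 + (1 / (2 * K)) * (1 - (h \<bullet> b)\<^sup>2)"
        using B(3)[OF b] unfolding rank1_matrix_mult
        by (simp add: inner_simps c_def norm_eq_1 power2_eq_square algebra_simps)
      moreover have "(rank1_matrix (1 / (2 * c) - 1 / (2 * K)) h (1 / (2 * K)) *v b) \<bullet> b \<le> R b"
        using order_trans[OF q_support_ge[OF hA] R[OF b]] by simp
      ultimately show ?thesis by linarith
    qed
    then have "(\<Sum>b\<in>B. M * (h \<bullet> b)\<^sup>2) \<le> (\<Sum>b\<in>B. \<bar>R b\<bar>)" by (rule sum_mono)
    moreover have "(\<Sum>b\<in>B. M * (h \<bullet> b)\<^sup>2) = M"
    proof -
      have "h = (\<Sum>b\<in>B. (h \<bullet> b) *\<^sub>R b)"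
        using orthonormal_basis_expand[OF B(2,3) _ finB] h(1) B(5) by metis
      then have "h \<bullet> h = (\<Sum>b\<in>B. (h \<bullet> b)\<^sup>2)"
        by (metis (no_types, lifting) inner_sum_right inner_scaleR_right power2_eq_square sum.cong)
      then show ?thesis using h(2) by (simp add: norm_eq_1 flip: sum_distrib_left)
    qed
    ultimately show False unfolding M_def by simp
  qed
  then show ?thesis using that c by blast
qed

text \<open>The equation says that the \<open>U\<close>-component of \<open>m z - xbar\<close> is \<open>u\<close>, which is the
  stationarity condition of \<open>z \<mapsto> conjugate z - (xbar + u) \<bullet> z\<close> on \<open>U\<close>.\<close>

lemma tilt_with_given_U_component:
  assumes U: "subspace U" and c: "c > 0" and \<sigma>: "\<sigma> > 0" "\<sigma> \<le> \<eta>"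
    and mono: "\<And>z1 z2. z1 \<in> U \<inter> ball 0 \<sigma> \<Longrightarrow> z2 \<in> U \<inter> ball 0 \<sigma>
      \<Longrightarrow> c * (norm (z1 - z2))\<^sup>2 \<le> (m z1 - m z2) \<bullet> (z1 - z2)"
    and u: "norm u < c * \<sigma> / 2"
  obtains z where "z \<in> U \<inter> ball 0 \<sigma>" "\<And>d. d \<in> U \<Longrightarrow> (m z - xbar - u) \<bullet> d = 0"
proof -
  define G where "G z = conjugate z - (xbar + u) \<bullet> z" for z
  let ?C = "U \<inter> cball 0 (\<sigma> / 2)"
  have C: "?C \<subseteq> U \<inter> ball 0 \<sigma>" "?C \<subseteq> ball 0 \<eta>" using \<sigma> by auto
  have "continuous_on (ball 0 \<eta>) conjugate"
    by (rule has_derivative_continuous_on[OF has_derivative_of_subgradients[OF conjugate_subgradient lipschitz]])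
  then have "continuous_on ?C G"
    unfolding G_def using C(2) by (intro continuous_intros) (rule continuous_on_subset)
  moreover have "compact ?C" using closed_subspace[OF U] by (simp add: closed_Int_compact)
  moreover have "0 \<in> ?C" using subspace_0[OF U] \<sigma> by simp
  ultimately obtain z where z: "z \<in> ?C" and min: "\<And>y. y \<in> ?C \<Longrightarrow> G z \<le> G y"
    using continuous_attains_inf by (metis empty_iff)
  define e where "e = m z - xbar - u"
  \<comment> \<open>First-order condition for the minimiser of \<open>G\<close> in a feasible
    direction.\<close>
  have dir: "0 \<le> e \<bullet> d" if ev: "\<forall>\<^sub>F t in at_right (0::real). z + t *\<^sub>R d \<in> ?C" for d
  proof (rule nonneg_of_quadratic_expansion)
    show "\<forall>\<^sub>F t in at_right 0. 0 \<le> t * (e \<bullet> d) + t\<^sup>2 * (L * (norm d)\<^sup>2)"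
      using ev
    proof eventually_elim
      case (elim t)
      have "conjugate (z + t *\<^sub>R d) \<le> conjugate z + t * (m z \<bullet> d) + L * (norm (t *\<^sub>R d))\<^sup>2"
        using upper_estimate_of_subgradients[OF conjugate_subgradient lipschitz
            subsetD[OF C(2) z] subsetD[OF C(2) elim]] by simp
      then show ?case
        using min[OF elim] unfolding G_def e_def
        by (simp add: inner_simps power_mult_distrib algebra_simps)
    qed
  qed
  \<comment> \<open>The inward direction \<open>- z\<close> together with monotonicity against
    \<open>m 0 = xbar\<close> gives \<open>c * norm z \<le> norm u\<close>. So \<open>z\<close> is
    interior in \<open>U\<close>, and every direction of \<open>U\<close> is feasible with both
    signs.\<close>
  have "norm z < \<sigma> / 2"
  proof (cases "z = 0")
    case False
    have "\<forall>\<^sub>F t in at_right (0::real). t < 1 \<and> 0 < t"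
      by (auto simp: eventually_at_right_field intro: exI[of _ 1])
    then have "\<forall>\<^sub>F t in at_right (0::real). z + t *\<^sub>R (- z) \<in> ?C"
    proof eventually_elim
      case (elim t)
      have "z + t *\<^sub>R (- z) = (1 - t) *\<^sub>R z" by (simp add: algebra_simps)
      moreover have "norm ((1 - t) *\<^sub>R z) \<le> 1 * norm z"
        unfolding norm_scaleR using elim by (intro mult_right_mono) auto
      ultimately show ?case using z subspace_scale[OF U] by auto
    qed
    from dir[OF this] have "(m z - xbar) \<bullet> z \<le> u \<bullet> z" unfolding e_def by (simp add: inner_simps)
    also have "\<dots> \<le> norm u * norm z" by (rule norm_cauchy_schwarz)
    finally have "c * (norm z)\<^sup>2 \<le> norm u * norm z"
      using mono[of z 0] z C subspace_0[OF U] \<sigma> m_0 by auto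
    then have "c * norm z \<le> norm u"
      using False by (simp add: power2_eq_square)
    then have "c * norm z < c * (\<sigma> / 2)" using u by simp
    then show ?thesis using c by simp
  qed (use \<sigma> in simp)
  have pos: "0 \<le> e \<bullet> d" if d: "d \<in> U" for d
  proof (rule dir)
    have "((\<lambda>t. z + t *\<^sub>R d) \<longlongrightarrow> z) (at_right (0::real))" by (auto intro!: tendsto_eq_intros)
    then have "\<forall>\<^sub>F t in at_right (0::real). z + t *\<^sub>R d \<in> ball 0 (\<sigma> / 2)"
      using \<open>norm z < \<sigma> / 2\<close> by (intro topological_tendstoD) auto
    then show "\<forall>\<^sub>F t in at_right (0::real). z + t *\<^sub>R d \<in> ?C"
      using z d subspace_add[OF U] subspace_scale[OF U] by (auto elim!: eventually_mono)
  qed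
  have "e \<bullet> d = 0" if "d \<in> U" for d
    using pos[OF that] pos[OF subspace_neg[OF U that]] by simp
  then show ?thesis using that z C unfolding e_def by blast
qed

section \<open>Agreement with the convex hull and identification of \<open>v\<close>\<close>

text \<open>The epigraph of the supporting affine function is a closed half-space containing the
  epigraph of the localised function, hence its closed convex hull; its boundary passes through the
  contact point.\<close>

lemma closed_convex_hull_fun_at_minimiser:
  assumes z: "z \<in> ball 0 \<eta>" and box: "(\<lambda>w. xbar + w) ` box_sum U \<epsilon> \<subseteq> cball xbar \<rho>"
    and mem: "m z - xbar \<in> box_sum U \<epsilon>"
  shows "closed_convex_hull_fun (local_fun f xbar U \<epsilon>) (m z - xbar) = f (m z)"
proof (rule antisym)
  let ?E = "epi (local_fun f xbar U \<epsilon>)"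
  have "(m z - xbar, val z) \<in> closure (convex hull ?E)"
    using mem f_m[OF z] by (intro subsetD[OF closure_subset] hull_inc) (simp add: epi_def local_fun_def)
  then show "closed_convex_hull_fun (local_fun f xbar U \<epsilon>) (m z - xbar) \<le> f (m z)"
    unfolding closed_convex_hull_fun_def f_m[OF z] by (auto intro: Inf_lower)
  define T :: "((real^'n) \<times> real) set" where "T = {p. (- z, 1) \<bullet> p \<ge> val z + z \<bullet> (xbar - m z)}"
  have "?E \<subseteq> T"
  proof clarify
    fix w t assume "(w, t) \<in> ?E"
    then have w: "w \<in> box_sum U \<epsilon>" "f (xbar + w) \<le> ereal t"
      unfolding epi_def local_fun_def by (auto split: if_splits)
    then have "ereal (val z + z \<bullet> (xbar + w - m z)) \<le> ereal t"
      using box by (intro order_trans[OF support[OF z] w(2)]) auto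
    then show "(w, t) \<in> T" unfolding T_def by (simp add: inner_simps)
  qed
  moreover have "convex T" "closed T"
    unfolding T_def by (auto intro: convex_halfspace_ge closed_halfspace_ge)
  ultimately have "closure (convex hull ?E) \<subseteq> T"
    by (intro closure_minimal hull_minimal)
  then have "val z \<le> t" if "(m z - xbar, t) \<in> closure (convex hull ?E)" for t
    using that unfolding T_def by (auto simp: inner_simps)
  then show "f (m z) \<le> closed_convex_hull_fun (local_fun f xbar U \<epsilon>) (m z - xbar)"
    unfolding closed_convex_hull_fun_def f_m[OF z] by (auto intro!: Inf_greatest)
qed

text \<open>A tilt in \<open>U\<close> is constant on the slice of points
  \<open>xbar + u + v'\<close> with \<open>v'\<close> orthogonal to \<open>U\<close>, so the tilted
  minimiser is also the untilted one on its slice.\<close>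

lemma v_argmin_at_minimiser:
  assumes box: "(\<lambda>w. xbar + w) ` box_sum U \<epsilon> \<subseteq> cball xbar \<rho>"
    and z: "z \<in> U" "z \<in> ball 0 \<eta>" and u: "u \<in> U" "norm u \<le> \<epsilon>"
    and v: "m z - xbar - u \<in> orthogonal_comp U \<inter> cball 0 \<epsilon>"
  shows "v_argmin f xbar U \<epsilon> u = {m z - xbar - u}"
proof -
  let ?S = "orthogonal_comp U \<inter> cball 0 \<epsilon>"
  let ?v = "m z - xbar - u"
  have mem: "xbar + u + v' \<in> cball xbar \<rho>" if "v' \<in> ?S" for v'
    using that u box unfolding box_sum_def by (force simp: add.assoc)
  have ortho: "z \<bullet> v' = 0" if "v' \<in> ?S" for v'
    using that z(1) unfolding orthogonal_comp_def orthogonal_def by auto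
  have tilt0: "z \<bullet> (xbar + u + v' - m z) = 0" if "v' \<in> ?S" for v'
    using ortho[OF that] ortho[OF v] by (simp add: inner_simps)
  have at_v: "f (xbar + u + ?v) = ereal (val z)" using f_m[OF z(2)] by simp
  have least: "ereal (val z) \<le> f (xbar + u + v')" if "v' \<in> ?S" for v'
    using support[OF z(2) mem[OF that]] tilt0[OF that] by simp
  have unique: "v' = ?v" if "v' \<in> ?S" "f (xbar + u + v') \<le> ereal (val z)" for v'
  proof -
    have "xbar + u + v' = m z"
      by (rule support_unique[OF z(2) mem[OF that(1)]]) (simp only: tilt0[OF that(1)] that(2) add_0_right)
    then show ?thesis by (simp add: algebra_simps)
  qed
  have "is_arg_min (\<lambda>v'. f (xbar + u + v')) (\<lambda>v'. v' \<in> ?S) v' \<longleftrightarrow> v' = ?v" for v'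
  proof
    assume "is_arg_min (\<lambda>v'. f (xbar + u + v')) (\<lambda>v'. v' \<in> ?S) v'"
    then show "v' = ?v"
      using unique[of v'] v unfolding is_arg_min_def at_v[symmetric] not_ex de_Morgan_conj not_less
      by blast
  next
    assume "v' = ?v"
    then show "is_arg_min (\<lambda>v'. f (xbar + u + v')) (\<lambda>v'. v' \<in> ?S) v'"
      using v least at_v unfolding is_arg_min_def by (metis not_less)
  qed
  then show ?thesis
    unfolding v_argmin_def argmin_set_def by blast
qed

section \<open>The Lipschitz gradient along \<open>U2\<close>\<close>

lemma partial_smoothness:
  assumes U: "subspace (U2 f xbar)" and \<epsilon>: "\<epsilon> > 0"
    and box: "(\<lambda>w. xbar + w) ` box_sum (U2 f xbar) \<epsilon> \<subseteq> cball xbar \<rho>"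
  defines "v \<equiv> v_sel f xbar (U2 f xbar) \<epsilon>"
    and "g \<equiv> closed_convex_hull_fun (local_fun f xbar (U2 f xbar) \<epsilon>)"
  shows "\<exists>\<delta>>0. (\<forall>u \<in> U2 f xbar \<inter> cball 0 \<delta>.
        v_argmin f xbar (U2 f xbar) \<epsilon> u = {v u} \<and> g (u + v u) = f (xbar + u + v u)) \<and>
      (\<exists>G L. (\<forall>u \<in> U2 f xbar \<inter> cball 0 \<delta>. has_gradient_in (U2 f xbar) (\<lambda>u. g (u + v u)) (G u) u) \<and>
        L-lipschitz_on (U2 f xbar \<inter> cball 0 \<delta>) G)"
proof -
  define U where "U = U2 f xbar"
  have subU: "subspace U" using U U_def by simp
  obtain c \<sigma>0 where c: "c > 0" and \<sigma>0: "\<sigma>0 > 0" "\<sigma>0 \<le> \<eta>"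
    and mono0: "\<And>z1 z2. z1 \<in> U \<inter> ball 0 \<sigma>0 \<Longrightarrow> z2 \<in> U \<inter> ball 0 \<sigma>0
      \<Longrightarrow> c * (norm (z1 - z2))\<^sup>2 \<le> (m z1 - m z2) \<bullet> (z1 - z2)"
    using strongly_monotone_on_U2[OF U] unfolding U_def by metis
  \<comment> \<open>\<open>L * \<sigma> \<le> \<epsilon>\<close> bounds \<open>m z - xbar\<close>;
    by Pythagoras both of its components then lie in the \<epsilon>-balls.\<close>
  define \<sigma> where "\<sigma> = min \<sigma>0 (\<epsilon> / L)"
  have \<sigma>: "\<sigma> > 0" "\<sigma> \<le> \<eta>" "\<sigma> \<le> \<sigma>0" "L * \<sigma> \<le> \<epsilon>"
  proof -
    have "\<sigma> \<le> \<epsilon> / L" unfolding \<sigma>_def by simp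
    then show "L * \<sigma> \<le> \<epsilon>" using L_pos by (simp add: field_simps)
  qed (use \<sigma>0 \<epsilon> L_pos in \<open>auto simp: \<sigma>_def\<close>)
  have mono: "c * (norm (z1 - z2))\<^sup>2 \<le> (m z1 - m z2) \<bullet> (z1 - z2)"
    if "z1 \<in> U \<inter> ball 0 \<sigma>" "z2 \<in> U \<inter> ball 0 \<sigma>" for z1 z2
    using that \<sigma>(3) by (intro mono0) auto
  \<comment> \<open>Half the solvable radius: the closed ball of radius \<delta> has a relatively
    open neighbourhood in \<open>U\<close> on which derivatives can be taken.\<close>
  define \<delta> where "\<delta> = c * \<sigma> / 4"
  have \<delta>: "\<delta> > 0" unfolding \<delta>_def using c \<sigma> by simp
  let ?N = "U \<inter> ball 0 (2 * \<delta>)"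
  have "\<exists>z. z \<in> U \<inter> ball 0 \<sigma> \<and> (\<forall>d\<in>U. (m z - xbar - u) \<bullet> d = 0)" if "u \<in> ?N" for u
  proof -
    have "norm u < c * \<sigma> / 2" using that unfolding \<delta>_def by (simp add: mult.commute)
    then obtain z where "z \<in> U \<inter> ball 0 \<sigma>" "\<And>d. d \<in> U \<Longrightarrow> (m z - xbar - u) \<bullet> d = 0"
      using tilt_with_given_U_component[OF subU c \<sigma>(1,2) mono] by blast
    then show ?thesis by blast
  qed
  then obtain \<zeta> where \<zeta>: "\<And>u. u \<in> ?N \<Longrightarrow> \<zeta> u \<in> U \<inter> ball 0 \<sigma>"
      and \<zeta>_eq: "\<And>u d. u \<in> ?N \<Longrightarrow> d \<in> U \<Longrightarrow> (m (\<zeta> u) - xbar - u) \<bullet> d = 0"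
    by metis
  have \<zeta>b: "\<zeta> u \<in> ball 0 \<eta>" if "u \<in> ?N" for u using \<zeta>[OF that] \<sigma>(2) by auto
  have comp: "m (\<zeta> u) - xbar - u \<in> orthogonal_comp U \<inter> cball 0 \<epsilon>" "norm u \<le> \<epsilon>" if u: "u \<in> ?N" for u
  proof -
    let ?v = "m (\<zeta> u) - xbar - u"
    have "L * norm (\<zeta> u) \<le> L * \<sigma>" using \<zeta>[OF u] L_pos by simp
    then have le: "norm (u + ?v) \<le> \<epsilon>" using dist_m_xbar[OF \<zeta>b[OF u]] \<sigma>(4) by simp
    have "orthogonal u ?v" using \<zeta>_eq[OF u, of u] u unfolding orthogonal_def by (simp add: inner_commute)
    from norm_add_Pythagorean[OF this]
    have "(norm u)\<^sup>2 \<le> (norm (u + ?v))\<^sup>2" "(norm ?v)\<^sup>2 \<le> (norm (u + ?v))\<^sup>2" by simp_all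
    then have "norm u \<le> norm (u + ?v)" "norm ?v \<le> norm (u + ?v)"
      using power2_le_imp_le norm_ge_zero by blast+
    then show "?v \<in> orthogonal_comp U \<inter> cball 0 \<epsilon>" "norm u \<le> \<epsilon>"
      using le \<zeta>_eq[OF u] unfolding orthogonal_comp_def orthogonal_def by (auto simp: inner_commute)
  qed
  have argmin_v: "v_argmin f xbar U \<epsilon> u = {m (\<zeta> u) - xbar - u}" if u: "u \<in> ?N" for u
    using u \<zeta>[OF u] \<zeta>b[OF u] comp[OF u] box
    by (intro v_argmin_at_minimiser) (auto simp: U_def)
  have v_eq: "v u = m (\<zeta> u) - xbar - u" if u: "u \<in> ?N" for u
    unfolding v_def v_sel_def U_def[symmetric] argmin_v[OF u] by auto
  have g_eq: "g (u + v u) = f (m (\<zeta> u))" if u: "u \<in> ?N" for u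
  proof -
    have "u + (m (\<zeta> u) - xbar - u) \<in> box_sum U \<epsilon>"
      unfolding box_sum_def mem_Collect_eq using u comp[OF u]
      by (intro exI[of _ u] exI[of _ "m (\<zeta> u) - xbar - u"]) simp
    then have "m (\<zeta> u) - xbar \<in> box_sum U \<epsilon>" by simp
    then show ?thesis
      using closed_convex_hull_fun_at_minimiser[OF \<zeta>b[OF u] box] unfolding g_def v_eq[OF u] U_def by simp
  qed
  have g_val: "g (u + v u) = ereal (val (\<zeta> u))" if "u \<in> ?N" for u
    using g_eq[OF that] f_m[OF \<zeta>b[OF that]] by simp
  \<comment> \<open>The \<open>U\<close>-component of \<open>m (\<zeta> u) - m (\<zeta> u')\<close>
    is \<open>u - u'\<close>, so strong monotonicity of \<open>m\<close> inverts to a Lipschitz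
    bound on \<zeta>.\<close>
  have \<zeta>_lip: "c * norm (\<zeta> u - \<zeta> u') \<le> norm (u - u')" if u: "u \<in> ?N" "u' \<in> ?N" for u u'
  proof (cases "\<zeta> u = \<zeta> u'")
    case False
    have d: "\<zeta> u - \<zeta> u' \<in> U" using \<zeta>[OF u(1)] \<zeta>[OF u(2)] subspace_diff[OF subU] by auto
    have "c * (norm (\<zeta> u - \<zeta> u'))\<^sup>2 \<le> (m (\<zeta> u) - m (\<zeta> u')) \<bullet> (\<zeta> u - \<zeta> u')"
      by (rule mono[OF \<zeta>[OF u(1)] \<zeta>[OF u(2)]])
    also have "\<dots> = (u - u') \<bullet> (\<zeta> u - \<zeta> u')"
      using \<zeta>_eq[OF u(1) d] \<zeta>_eq[OF u(2) d] by (simp add: inner_diff_left)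
    also have "\<dots> \<le> norm (u - u') * norm (\<zeta> u - \<zeta> u')" by (rule norm_cauchy_schwarz)
    finally show ?thesis using False by (simp add: power2_eq_square)
  qed simp
  \<comment> \<open>As \<open>\<zeta> u\<close> lies in \<open>U\<close>, it sees only the
    \<open>U\<close>-component of the minimisers; hence it is a subgradient of the value as a
    function of \<open>u\<close>.\<close>
  have val_ge: "val (\<zeta> u) + \<zeta> u \<bullet> (u' - u) \<le> val (\<zeta> u')" if u: "u \<in> ?N" "u' \<in> ?N" for u u'
  proof -
    have "\<zeta> u \<bullet> (m (\<zeta> u') - m (\<zeta> u)) = \<zeta> u \<bullet> (u' - u)"
      using \<zeta>_eq[OF u(1), of "\<zeta> u"] \<zeta>_eq[OF u(2), of "\<zeta> u"] \<zeta>[OF u(1)]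
      by (simp add: inner_simps inner_commute)
    then show ?thesis
      using support[OF \<zeta>b[OF u(1)] m_argmin(1)[OF \<zeta>b[OF u(2)]]] f_m[OF \<zeta>b[OF u(2)]] by simp
  qed
  have grad: "has_gradient_in U (\<lambda>u. g (u + v u)) (\<zeta> u) u" if u: "u \<in> ?N" for u
  proof -
    have ev: "\<forall>\<^sub>F u' in at u within U. u' \<in> ?N"
      using u by (auto simp: eventually_at_topological intro!: exI[of _ "ball 0 (2 * \<delta>)"])
    have "\<forall>\<^sub>F u' in at u within U. norm (real_of_ereal (g (u' + v u')) - real_of_ereal (g (u + v u))
        - \<zeta> u \<bullet> (u' - u)) \<le> (1 / c) * (norm (u' - u))\<^sup>2"
      using ev
    proof eventually_elim
      case (elim u')
      have "(\<zeta> u' - \<zeta> u) \<bullet> (u' - u) \<le> norm (\<zeta> u' - \<zeta> u) * norm (u' - u)" by (rule norm_cauchy_schwarz)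
      also have "\<dots> \<le> (norm (u' - u) / c) * norm (u' - u)"
        using \<zeta>_lip[OF elim u] c by (intro mult_right_mono) (auto simp: field_simps)
      finally have "(\<zeta> u' - \<zeta> u) \<bullet> (u' - u) \<le> (1 / c) * (norm (u' - u))\<^sup>2"
        by (simp add: power2_eq_square)
      moreover have "val (\<zeta> u) + \<zeta> u \<bullet> (u' - u) \<le> val (\<zeta> u')" by (rule val_ge[OF u elim])
      moreover have "val (\<zeta> u') + \<zeta> u' \<bullet> (u - u') \<le> val (\<zeta> u)" by (rule val_ge[OF elim u])
      ultimately show ?case
        using g_val[OF u] g_val[OF elim] by (simp add: inner_simps)
    qed
    then have "((\<lambda>u'. real_of_ereal (g (u' + v u'))) has_derivative (\<lambda>d. \<zeta> u \<bullet> d)) (at u within U)"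
      by (rule has_derivative_quadratic_error[OF bounded_linear_inner_right])
    moreover have "\<forall>\<^sub>F u' in at u within U. \<bar>g (u' + v u')\<bar> \<noteq> \<infinity>"
      using ev by eventually_elim (simp add: g_val)
    ultimately show ?thesis
      unfolding has_gradient_in_def using u \<zeta>[OF u] g_val[OF u] by simp
  qed
  have N: "u \<in> ?N" if "u \<in> U \<inter> cball 0 \<delta>" for u using that \<delta> by auto
  have lip: "(1 / c)-lipschitz_on (U \<inter> cball 0 \<delta>) \<zeta>"
    using \<zeta>_lip[OF N N] c by (intro lipschitz_onI) (auto simp: dist_norm field_simps)
  have at: "v_argmin f xbar U \<epsilon> u = {v u} \<and> g (u + v u) = f (xbar + u + v u)"
    if "u \<in> U \<inter> cball 0 \<delta>" for u
  proof
    have u: "u \<in> ?N" using N that .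
    show "v_argmin f xbar U \<epsilon> u = {v u}" unfolding v_eq[OF u] by (rule argmin_v[OF u])
    have "xbar + u + v u = m (\<zeta> u)" unfolding v_eq[OF u] by simp
    then show "g (u + v u) = f (xbar + u + v u)" using g_eq[OF u] by simp
  qed
  show ?thesis
    unfolding U_def[symmetric]
  proof (intro exI conjI ballI)
    show "\<delta> > 0" by (rule \<delta>)
    show "(1 / c)-lipschitz_on (U \<inter> cball 0 \<delta>) \<zeta>" by (rule lip)
  next
    fix u assume u: "u \<in> U \<inter> cball 0 \<delta>"
    show "v_argmin f xbar U \<epsilon> u = {v u}" "g (u + v u) = f (xbar + u + v u)"
      using at[OF u] by blast+
    show "has_gradient_in U (\<lambda>u. g (u + v u)) (\<zeta> u) u" by (rule grad[OF N[OF u]])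
  qed
qed

end

text \<open>The choice of \<epsilon> consistent with tilt stability is expressed by placing the box
  inside a ball of tilt stability. If the subdifferential is convex, the closure condition follows
  from \<open>0\<close> belonging to it; a limiting subdifferential may be nonconvex.\<close>

theorem theorem1:
  fixes f :: "real^'n \<Rightarrow> ereal" and xbar :: "real^'n"
  assumes proper: "proper_fun f"
    and lsc: "lsc_fun f"
    and minorised: "quadratically_minorised f xbar"
    and prox: "prox_regular f xbar 0"
    and U2_subspace: "subspace (U2 f xbar)"
    and U2_nontrivial: "U2 f xbar \<noteq> {0}"
    and tilt: "tilt_stable_local_min f xbar"
  shows "(\<forall>zbar \<in> rel_interior (limiting_subdiff f xbar).
            0 \<in> closure (rel_interior (limiting_subdiff f xbar)) \<longrightarrow>
            U2 f xbar \<subseteq> VU_U f xbar zbar)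
       \<and> (\<forall>\<epsilon>>0. (\<exists>\<rho>. tilt_stable_on_radius f xbar \<rho> \<and>
                     (\<lambda>w. xbar + w) ` box_sum (U2 f xbar) \<epsilon> \<subseteq> cball xbar \<rho>) \<longrightarrow>
            (let U = U2 f xbar;
                 v = v_sel f xbar U \<epsilon>;
                 g = closed_convex_hull_fun (local_fun f xbar U \<epsilon>)
             in \<exists>\<delta>>0.
                  (\<forall>u \<in> U \<inter> cball 0 \<delta>.
                     v_argmin f xbar U \<epsilon> u = {v u} \<and>
                     g (u + v u) = f (xbar + u + v u)) \<and>
                  (\<exists>G L. (\<forall>u \<in> U \<inter> cball 0 \<delta>. has_gradient_in U (\<lambda>u. g (u + v u)) (G u) u) \<and>
                         L-lipschitz_on (U \<inter> cball 0 \<delta>) G)))"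
proof (intro conjI ballI allI impI)
  fix zbar
  assume "zbar \<in> rel_interior (limiting_subdiff f xbar)"
    "0 \<in> closure (rel_interior (limiting_subdiff f xbar))"
  then show "U2 f xbar \<subseteq> VU_U f xbar zbar" by (rule U2_subset_VU_U[OF prox])
next
  fix \<epsilon> :: real
  assume \<epsilon>: "\<epsilon> > 0" and "\<exists>\<rho>. tilt_stable_on_radius f xbar \<rho> \<and>
    (\<lambda>w. xbar + w) ` box_sum (U2 f xbar) \<epsilon> \<subseteq> cball xbar \<rho>"
  then obtain \<rho> where box: "(\<lambda>w. xbar + w) ` box_sum (U2 f xbar) \<epsilon> \<subseteq> cball xbar \<rho>"
    and \<rho>: "tilt_stable_on_radius f xbar \<rho>" by blast
  from \<rho> obtain m \<eta> L where stable: "\<rho> > 0" "\<bar>f xbar\<bar> \<noteq> \<infinity>" "\<eta> > 0"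
      "\<And>z. z \<in> ball 0 \<eta> \<Longrightarrow> argmin_set (\<lambda>x. f x - ereal (x \<bullet> z)) (cball xbar \<rho>) = {m z}"
      "L-lipschitz_on (ball 0 \<eta>) m" "m 0 = xbar"
    unfolding tilt_stable_on_radius_def by metis
  \<comment> \<open>Enlarging the constant makes it positive, as the locale requires.\<close>
  have "(max L 1)-lipschitz_on (ball 0 \<eta>) m"
    by (rule lipschitz_on_le[OF stable(5)]) simp
  then interpret tilt_selection f xbar \<rho> \<eta> "max L 1" m
    by unfold_locales (use stable proper in \<open>simp_all add: proper_fun_def\<close>)
  show "let U = U2 f xbar; v = v_sel f xbar U \<epsilon>; g = closed_convex_hull_fun (local_fun f xbar U \<epsilon>)
    in \<exists>\<delta>>0. (\<forall>u \<in> U \<inter> cball 0 \<delta>. v_argmin f xbar U \<epsilon> u = {v u} \<and> g (u + v u) = f (xbar + u + v u)) \<and>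
      (\<exists>G L. (\<forall>u \<in> U \<inter> cball 0 \<delta>. has_gradient_in U (\<lambda>u. g (u + v u)) (G u) u) \<and>
        L-lipschitz_on (U \<inter> cball 0 \<delta>) G)"
    unfolding Let_def by (rule partial_smoothness[OF U2_subspace \<epsilon> box])
qed

end
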